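(* Let $\kappa$ be a real-valued measurable cardinal. Then $\binom{\theta}{\omega}\nrightarrow\binom{\aleph_1}{\omega}^{1,1}_2$ for every cardinal $\theta<\kappa$.
   Context: $\kappa$ is real-valued measurable if there is a $\kappa$-additive probability measure $m:\mathcal{P}(\kappa)\to[0,1]$ which vanishes on singletons and is atomless. For cardinals $\theta$ and $\mu$, $\binom{\theta}{\omega}\nrightarrow\binom{\mu}{\omega}^{1,1}_2$ means: there is $c:\theta\times\omega\to 2$ such that there are no $A\in[\theta]^{\mu}$, $B\in[\omega]^\omega$ with $c\upharpoonright(A\times B)$ constant. *)

theory Defs
  imports "HOL-Probability.Probability"
begin

unbundle cardinal_syntax

text \<open>
  Cardinals are wellorders satisfying \<^const>\<open>Card_order\<close>, compared across types by
  \<open><o\<close> and \<open>=o\<close>; the underlying set of a cardinal is its \<^const>\<open>Field\<close>.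
\<close>

text \<open>
  The families in \<open>kappa_additive\<close> are indexed by sets of elements of the type underlying \<open>\<kappa>\<close>;
  every cardinal below \<open>\<kappa>\<close> occurs among their sizes. The possibly uncountable sum is
  unordered.
\<close>

definition kappa_additive :: "'k rel \<Rightarrow> 'k measure \<Rightarrow> bool" where
  "kappa_additive \<kappa> M \<longleftrightarrow>
    (\<forall>(I :: 'k set) X. |I| <o \<kappa> \<longrightarrow> (\<forall>i\<in>I. X i \<in> sets M) \<longrightarrow> disjoint_family_on X I \<longrightarrow>
       ((\<lambda>i. measure M (X i)) has_sum measure M (\<Union>i\<in>I. X i)) I)"

definition atomless :: "'k measure \<Rightarrow> bool" where
  "atomless M \<longleftrightarrow>
    (\<forall>X\<in>sets M. 0 < measure M X \<longrightarrow>
       (\<exists>Y\<in>sets M. Y \<subseteq> X \<and> 0 < measure M Y \<and> measure M Y < measure M X))"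

text \<open>
  Countable additivity is part of \<^const>\<open>prob_space\<close>; since \<open>M\<close> vanishes on singletons, it
  forces \<open>\<kappa>\<close> to be uncountable.
\<close>

definition real_valued_measurable :: "'k rel \<Rightarrow> bool" where
  "real_valued_measurable \<kappa> \<longleftrightarrow> Card_order \<kappa> \<and>
    (\<exists>M. prob_space M \<and> sets M = Pow (Field \<kappa>) \<and> kappa_additive \<kappa> M \<and>
       (\<forall>x\<in>Field \<kappa>. measure M {x} = 0) \<and> atomless M)"

text \<open>
  The polarized partition relation \<open>(\<theta>, l) \<rightarrow> (\<mu>, \<nu>)\<close> with superscript \<open>1,1\<close> and two
  colours, which are the elements of \<^typ>\<open>bool\<close>.
\<close>

definition polarized_arrow :: "'a rel \<Rightarrow> 'b rel \<Rightarrow> 'c rel \<Rightarrow> 'd rel \<Rightarrow> bool" where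
  "polarized_arrow \<theta> l \<mu> \<nu> \<longleftrightarrow>
    (\<forall>c :: 'a \<times> 'b \<Rightarrow> bool. \<exists>A B.
       A \<subseteq> Field \<theta> \<and> |A| =o \<mu> \<and> B \<subseteq> Field l \<and> |B| =o \<nu> \<and>
       c constant_on A \<times> B)"

end

theory Submission
  imports Defs
begin

text \<open>
  Given an independent family of events \<open>E (\<alpha>, n)\<close> of probability 1/2, \<open>\<alpha> < \<theta>\<close>, \<open>n < \<omega>\<close>, the colouring
  \<open>c\<^sub>x (\<alpha>, n) = (x \<in> E (\<alpha>, n))\<close> works for some \<open>x\<close>: if \<open>A\<^sub>x\<close> and \<open>B\<^sub>x\<close> are homogeneous for \<open>c\<^sub>x\<close>, then by
  Bessel's inequality all but countably many \<open>\<alpha>\<close> are independent of the countably many events that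
  describe \<open>B\<^sub>x\<close>, so \<open>\<alpha> \<in> A\<^sub>x\<close> has probability 0, whereas \<open>A\<^sub>x\<close> is uncountable.

  A maximal independent family of events has at least \<open>\<kappa>\<close> members. Otherwise, by Maharam's lemma, the
  restriction of the measure to some set of positive measure is generated by fewer than \<open>\<kappa>\<close> sets,
  which is impossible by a special case of the Gitik-Shelah theorem. For the latter, call a set
  \<^emph>\<open>generated null\<close> if it is covered by a null set of the \<open>\<sigma>\<close>-algebra of the generators. Take more than \<open>\<kappa>\<close>
  functions \<open>h : \<kappa> \<rightarrow> \<kappa>\<close> that are pairwise different almost everywhere. Each \<open>h\<close> agrees on a set \<open>Q h\<close> of
  full measure with a function \<open>\<phi> h\<close> measurable in the generators, and \<open>Q h\<close> meets some initial segment
  \<open>\<gamma>\<close> in a set that is not generated null, while \<open>h\<close> is bounded by some \<open>\<beta>\<close> on \<open>\<gamma>\<close>. Choose \<open>\<kappa>\<close> many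
  \<open>h\<^sub>i\<close> with the same \<open>\<gamma>\<close> and \<open>\<beta>\<close>. As there are fewer than \<open>\<kappa>\<close> pairs \<open>(y, b)\<close> below \<open>(\<gamma>, \<beta>)\<close>, for almost every
  \<open>i\<close> each value \<open>h\<^sub>i y = b\<close> with \<open>y < \<gamma>\<close> in \<open>Q h\<^sub>i\<close> is taken by \<open>\<phi> h\<^sub>j y\<close> for a nonnull set of \<open>j\<close>; by
  Tonelli's theorem the set of such \<open>y\<close> is generated null, a contradiction.
\<close>

section \<open>Approximation by a countable algebra\<close>

text \<open>A countable union of countable families is countable, so the sets built from countably
  many generators already exhaust the generated sigma-algebra.\<close>

lemma sigma_sets_countable_generators:
  assumes "A \<in> sigma_sets \<Omega> \<E>"
  shows "\<exists>\<C>. countable \<C> \<and> \<C> \<subseteq> \<E> \<and> A \<in> sigma_sets \<Omega> \<C>"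
  using assms
proof induction
  case (Basic a)
  then show ?case by (intro exI[of _ "{a}"]) auto
next
  case Empty
  then show ?case by (intro exI[of _ "{}"]) (auto intro: sigma_sets.Empty)
next
  case (Compl a)
  then show ?case by (meson sigma_sets.Compl)
next
  case (Union a)
  then obtain \<C> where C: "\<And>i::nat. countable (\<C> i) \<and> \<C> i \<subseteq> \<E> \<and> a i \<in> sigma_sets \<Omega> (\<C> i)"
    by metis
  have "a i \<in> sigma_sets \<Omega> (\<Union>(range \<C>))" for i
    using C[of i] sigma_sets_mono'[of "\<C> i" "\<Union>(range \<C>)" \<Omega>] by blast
  then show ?case
    using C by (intro exI[of _ "\<Union>(range \<C>)"]) (auto intro: sigma_sets.Union)
qed

text \<open>The sets that do not separate \<open>x\<close> from \<open>y\<close> are closed under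
  complements and countable unions.\<close>

lemma sigma_sets_same_side:
  assumes "A \<in> sigma_sets \<Omega> \<E>" "x \<in> \<Omega>" "y \<in> \<Omega>" "\<And>E. E \<in> \<E> \<Longrightarrow> x \<in> E \<longleftrightarrow> y \<in> E"
  shows "x \<in> A \<longleftrightarrow> y \<in> A"
  using assms(1) by induction (use assms in auto)

text \<open>
  Codes for the members of the algebra generated by a sequence of sets; countability of the type
  makes this algebra countable uniformly in the sequence.
\<close>

datatype bool_term = Gen nat | Neg bool_term | Conj bool_term bool_term

instance bool_term :: countable
  by countable_datatype

primrec bool_set :: "'a set \<Rightarrow> (nat \<Rightarrow> 'a set) \<Rightarrow> bool_term \<Rightarrow> 'a set" where
  "bool_set \<Omega> E (Gen n) = E n"
| "bool_set \<Omega> E (Neg t) = \<Omega> - bool_set \<Omega> E t"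
| "bool_set \<Omega> E (Conj s t) = bool_set \<Omega> E s \<inter> bool_set \<Omega> E t"

lemma bool_set_sigma: 
  assumes "range E \<subseteq> Pow \<Omega>"
  shows "bool_set \<Omega> E t \<in> sigma_sets \<Omega> (range E)"
proof -
  interpret sigma_algebra \<Omega> "sigma_sets \<Omega> (range E)"
    using assms by (rule sigma_algebra_sigma_sets)
  show ?thesis by (induction t) auto
qed

text \<open>The error of a union is covered by the errors of its terms, whose bounds sum to
  \<open>e\<close>.\<close>

lemma (in finite_measure) measure_Union_minus_le:
  assumes "\<And>n. A n \<in> sets M" "\<And>n. U n \<in> sets M" "\<And>n. measure M (U n - A n) < e * (1/2)^Suc n"
  shows "measure M ((\<Union>n. U n) - (\<Union>n. A n)) \<le> e"
proof -
  have s: "summable (\<lambda>n. e * (1/2)^Suc n)"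
    by (intro summable_mult) (use sums_summable[OF power_half_series] in simp)
  have s': "summable (\<lambda>n. measure M (U n - A n))"
    by (rule summable_comparison_test'[OF s, of 0]) (use assms(3) in \<open>auto intro: less_imp_le\<close>)
  have "measure M ((\<Union>n. U n) - (\<Union>n. A n)) \<le> measure M (\<Union>n. U n - A n)"
    using assms by (intro finite_measure_mono) auto
  also have "\<dots> \<le> (\<Sum>n. measure M (U n - A n))"
    using assms s' by (intro finite_measure_subadditive_countably) auto
  also have "\<dots> \<le> (\<Sum>n. e * (1/2)^Suc n)"
    using assms(3) s s' by (intro suminf_le) (auto intro: less_imp_le)
  also have "\<dots> = e"
    using power_half_series by (simp add: sums_iff suminf_mult del: power_Suc)
  finally show ?thesis .
qed

text \<open>Outer regularity with respect to the algebra of the generators. The union ranges over an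
  arbitrary set \<open>T\<close> of codes and is nevertheless countable. Approximability
  (\<open>ap\<close>) survives countable unions and countable intersections.\<close>

lemma (in finite_measure) sigma_sets_outer_approx:
  fixes E :: "nat \<Rightarrow> 'a set"
  assumes A: "A \<in> sigma_sets (space M) (range E)" and E: "range E \<subseteq> sets M" and "e > 0"
  obtains T where "A \<subseteq> (\<Union>t\<in>T. bool_set (space M) E t)"
    "measure M ((\<Union>t\<in>T. bool_set (space M) E t) - A) < e"
proof -
  let ?b = "bool_set (space M) E"
  define ap where "ap A \<longleftrightarrow> (\<forall>e>0. \<exists>T. A \<subseteq> \<Union>(?b ` T) \<and> measure M (\<Union>(?b ` T) - A) < e)" for A
  have b [measurable]: "?b t \<in> sets M" for t
    using E by (induction t) auto
  have bU [measurable]: "\<Union>(?b ` T) \<in> sets M" for T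
    by (intro sets.countable_UN') auto
  have S: "A \<in> sets M" if "A \<in> sigma_sets (space M) (range E)" for A
    using that E sets.sigma_sets_subset by blast
  have ap_Int: "ap (A \<inter> B)" if "ap A" "ap B" "A \<in> sets M" "B \<in> sets M" for A B
    unfolding ap_def
  proof (intro allI impI)
    fix e :: real assume "e > 0"
    then obtain T T' where T: "A \<subseteq> \<Union>(?b ` T)" "measure M (\<Union>(?b ` T) - A) < e/2"
        "B \<subseteq> \<Union>(?b ` T')" "measure M (\<Union>(?b ` T') - B) < e/2"
      using \<open>ap A\<close> \<open>ap B\<close> half_gt_zero unfolding ap_def by metis
    let ?T = "{Conj s t |s t. s \<in> T \<and> t \<in> T'}"
    have eq: "\<Union>(?b ` ?T) = \<Union>(?b ` T) \<inter> \<Union>(?b ` T')"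
    proof -
      have "x \<in> \<Union>(?b ` ?T)" if "s \<in> T" "t \<in> T'" "x \<in> ?b s" "x \<in> ?b t" for x s t
        using that by (intro UN_I[of "Conj s t"]) auto
      then show ?thesis by fastforce
    qed
    have "measure M (\<Union>(?b ` ?T) - A \<inter> B) \<le> measure M ((\<Union>(?b ` T) - A) \<union> (\<Union>(?b ` T') - B))"
      unfolding eq using that by (intro finite_measure_mono) auto
    also have "\<dots> \<le> measure M (\<Union>(?b ` T) - A) + measure M (\<Union>(?b ` T') - B)"
      using that by (intro measure_Un_le) auto
    finally have "measure M (\<Union>(?b ` ?T) - A \<inter> B) < e"
      using T by simp
    moreover have "A \<inter> B \<subseteq> \<Union>(?b ` ?T)"
      unfolding eq using T by blast
    ultimately show "\<exists>T. A \<inter> B \<subseteq> \<Union>(?b ` T) \<and> measure M (\<Union>(?b ` T) - A \<inter> B) < e"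
      by blast
  qed
  have ap_UN: "ap (\<Union>n. A n)" if "\<And>n. ap (A n)" "\<And>n. A n \<in> sets M" for A :: "nat \<Rightarrow> 'a set"
    unfolding ap_def
  proof (intro allI impI)
    fix e :: real assume "e > 0"
    \<comment> \<open>Starting from \<open>e / 2\<close> turns the weak bound of
      \<open>measure_Union_minus_le\<close> into a strict one.\<close>
    then have "e / 2 * (1/2)^Suc n > 0" for n
      by simp
    then have "\<exists>T. \<forall>n. A n \<subseteq> \<Union>(?b ` T n) \<and> measure M (\<Union>(?b ` T n) - A n) < e / 2 * (1/2)^Suc n"
      using that(1) unfolding ap_def by (intro choice) blast
    then obtain T where T: "\<And>n. A n \<subseteq> \<Union>(?b ` T n)"
        "\<And>n. measure M (\<Union>(?b ` T n) - A n) < e / 2 * (1/2)^Suc n"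
      by metis
    have "measure M ((\<Union>n. \<Union>(?b ` T n)) - (\<Union>n. A n)) \<le> e / 2"
      using T that by (intro measure_Union_minus_le) auto
    moreover have eq: "\<Union>(?b ` (\<Union>n. T n)) = (\<Union>n. \<Union>(?b ` T n))"
      by blast
    ultimately have "measure M (\<Union>(?b ` (\<Union>n. T n)) - (\<Union>n. A n)) < e"
      using \<open>e > 0\<close> by simp
    moreover have "(\<Union>n. A n) \<subseteq> \<Union>(?b ` (\<Union>n. T n))"
      unfolding eq using T(1) by (intro UN_mono) auto
    ultimately show "\<exists>T. (\<Union>n. A n) \<subseteq> \<Union>(?b ` T) \<and> measure M (\<Union>(?b ` T) - (\<Union>n. A n)) < e"
      by blast
  qed
  have ap_INT: "ap (\<Inter>n. A n)" if "\<And>n. ap (A n)" "\<And>n. A n \<in> sets M" for A :: "nat \<Rightarrow> 'a set"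
    unfolding ap_def
  proof (intro allI impI)
    fix e :: real assume "e > 0"
    \<comment> \<open>Continuity from above: some finite intersection \<open>B n\<close> has measure
      within \<open>e / 2\<close> of the full one, and finite intersections are settled by
      \<open>ap_Int\<close>.\<close>
    define B where "B n = (\<Inter>i\<le>n. A i)" for n
    have Bm: "B n \<in> sets M" for n
      unfolding B_def using that(2) by (intro sets.finite_INT) auto
    have Bap: "ap (B n)" for n
    proof (induction n)
      case (Suc n)
      have "B (Suc n) = B n \<inter> A (Suc n)" by (auto simp: B_def le_Suc_eq)
      then show ?case using Suc ap_Int that Bm by simp
    qed (use that in \<open>simp add: B_def\<close>)
    have "(\<lambda>n. measure M (B n)) \<longlonglongrightarrow> measure M (\<Inter>n. B n)"
      using Bm by (intro finite_Lim_measure_decseq) (auto simp: decseq_def B_def)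
    also have eq: "(\<Inter>n. B n) = (\<Inter>n. A n)" by (auto simp: B_def)
    finally have "eventually (\<lambda>n. measure M (B n) < measure M (\<Inter>n. A n) + e/2) sequentially"
      using \<open>e > 0\<close> by (intro order_tendstoD) auto
    then obtain n where n: "measure M (B n) < measure M (\<Inter>n. A n) + e/2"
      by (auto simp: eventually_sequentially)
    obtain T where T: "B n \<subseteq> \<Union>(?b ` T)" "measure M (\<Union>(?b ` T) - B n) < e/2"
      using Bap[of n] \<open>e > 0\<close> half_gt_zero unfolding ap_def by blast
    have sub: "(\<Inter>n. A n) \<subseteq> B n" by (auto simp: B_def)
    have Am: "(\<Inter>n. A n) \<in> sets M" using that(2) by auto
    have "measure M (\<Union>(?b ` T) - (\<Inter>n. A n)) = measure M (\<Union>(?b ` T)) - measure M (\<Inter>n. A n)"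
      using sub T(1) Am by (intro finite_measure_Diff) auto
    also have "\<dots> = measure M (\<Union>(?b ` T) - B n) + measure M (B n) - measure M (\<Inter>n. A n)"
      using finite_measure_Diff[OF bU Bm T(1)] by simp
    also have "\<dots> < e" using n T by simp
    finally show "\<exists>T. (\<Inter>n. A n) \<subseteq> \<Union>(?b ` T) \<and> measure M (\<Union>(?b ` T) - (\<Inter>n. A n)) < e"
      using sub T(1) by (intro exI[of _ T]) auto
  qed
  have ap_gen: "ap (?b t)" for t
    unfolding ap_def
  proof (intro allI impI)
    fix e :: real assume "e > 0"
    then show "\<exists>T. ?b t \<subseteq> \<Union>(?b ` T) \<and> measure M (\<Union>(?b ` T) - ?b t) < e"
      by (intro exI[of _ "{t}"]) auto
  qed
  \<comment> \<open>The induction carries each set together with its complement, so the complement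
    case is a swap and a union calls for an intersection as well.\<close>
  have "ap A \<and> ap (space M - A)"
    using A
  proof induction
    case (Basic a)
    then obtain n where "a = E n" by auto
    then show ?case using ap_gen[of "Gen n"] ap_gen[of "Neg (Gen n)"] by simp
  next
    case Empty
    have "ap {}" unfolding ap_def by (intro allI impI exI[of _ "{}"]) auto
    moreover have "?b (Neg (Gen 0)) \<union> ?b (Gen 0) = space M"
      using E sets.sets_into_space by auto
    then have "ap (space M)"
      using b unfolding ap_def
      by (intro allI impI exI[of _ "{Neg (Gen 0), Gen 0}"]) auto
    ultimately show ?case by simp
  next
    case (Compl a)
    then have "space M - (space M - a) = a"
      using S sets.sets_into_space by blast
    then show ?case using Compl by simp
  next
    case (Union a)
    have "space M - (\<Union>i. a i) = (\<Inter>i. space M - a i)" by auto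
    then show ?case using Union S ap_UN[of a] ap_INT[of "\<lambda>i. space M - a i"] by auto
  qed
  then show ?thesis using that \<open>e > 0\<close> unfolding ap_def by blast
qed

section \<open>Null sets of a real-valued measurable cardinal\<close>

text \<open>Of \<open>\<kappa>\<close>-additivity only the effect on null sets is kept. In this form
  it is inherited by the conditional measures \<open>uniform_measure M P\<close>.\<close>

locale real_valued_measure = prob_space M for M :: "'k measure" +
  fixes \<kappa> :: "'k rel"
  assumes Card: "Card_order \<kappa>"
    and sets_M: "sets M = Pow (Field \<kappa>)"
    and null_Union: "\<And>\<A>. |\<A>| <o \<kappa> \<Longrightarrow> \<A> \<subseteq> null_sets M \<Longrightarrow> \<Union>\<A> \<in> null_sets M"
    and null_singleton: "\<And>x. x \<in> Field \<kappa> \<Longrightarrow> {x} \<in> null_sets M"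
    and atomless: "atomless M"
begin

lemma space_M: "space M = Field \<kappa>"
proof
  show "space M \<subseteq> Field \<kappa>"
    using sets.top[of M] unfolding sets_M by simp
  show "Field \<kappa> \<subseteq> space M"
    by (rule sets.sets_into_space) (simp add: sets_M)
qed

lemma in_sets [simp]: "A \<in> sets M \<longleftrightarrow> A \<subseteq> Field \<kappa>"
  by (simp add: sets_M)

lemma null_subset:
  assumes "A \<in> null_sets M" "B \<subseteq> A"
  shows "B \<in> null_sets M"
proof (rule null_sets_subset[OF assms(1) _ assms(2)])
  show "B \<in> sets M"
    using null_setsD2[OF assms(1)] assms(2) by simp
qed

lemma null_UN:
  fixes I :: "'i set"
  assumes "|I| <o \<kappa>" "\<And>i. i \<in> I \<Longrightarrow> A i \<in> null_sets M"
  shows "(\<Union>i\<in>I. A i) \<in> null_sets M"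
  using assms card_of_image[of A I] by (intro null_Union) (auto intro: ordLeq_ordLess_trans)

lemma null_small: "|A| <o \<kappa> \<Longrightarrow> A \<subseteq> Field \<kappa> \<Longrightarrow> A \<in> null_sets M"
  using null_UN[of A "\<lambda>x. {x}"] null_singleton by auto

lemma not_null_Field: "Field \<kappa> \<notin> null_sets M"
  using emeasure_space_1 space_M by (auto simp: null_sets_def)

lemma uncountable_Field: "uncountable (Field \<kappa>)"
proof
  assume "countable (Field \<kappa>)"
  then have "(\<Union>x\<in>Field \<kappa>. {x}) \<in> null_sets M"
    using null_singleton by (intro null_sets_UN') auto
  then show False
    using not_null_Field by simp
qed

lemma card_nat_less: "|UNIV :: nat set| <o \<kappa>"
proof -
  have "\<not> |Field \<kappa>| \<le>o |UNIV :: nat set|"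
    using uncountable_Field unfolding countable_def card_of_ordLeq[symmetric] by simp
  then have "|UNIV :: nat set| <o |Field \<kappa>|"
    by (simp add: not_ordLeq_iff_ordLess card_of_Well_order)
  then show ?thesis
    using card_of_Field_ordIso[OF Card] by (rule ordLess_ordIso_trans)
qed

lemma infinite_Field: "infinite (Field \<kappa>)"
  using uncountable_Field countable_finite by blast

lemma card_countable_less:
  assumes "countable A"
  shows "|A| <o \<kappa>"
proof -
  have "|A| \<le>o |UNIV :: nat set|"
    using assms unfolding countable_def card_of_ordLeq[symmetric] by blast
  then show ?thesis
    using card_nat_less by (rule ordLeq_ordLess_trans)
qed

lemma card_insert_less: "|A| <o \<kappa> \<Longrightarrow> |insert a A| <o \<kappa>"
  using card_of_Un_ordLess_infinite_Field[OF infinite_Field Card, of "{a}" A] card_countable_less[of "{a}"]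
  by simp

lemma card_mono_less: "|B| <o \<kappa> \<Longrightarrow> A \<subseteq> B \<Longrightarrow> |A| <o \<kappa>"
  using card_of_mono1 ordLeq_ordLess_trans by blast

lemma in_underS_total: "x \<in> Field \<kappa> \<Longrightarrow> y \<in> Field \<kappa> \<Longrightarrow> x \<in> underS \<kappa> y \<or> x = y \<or> y \<in> underS \<kappa> x"
  using Card_order_wo_rel[OF Card] wo_rel.TOTALS by (fastforce simp: underS_def)

lemma null_insert_underS:
  assumes "x \<in> Field \<kappa>"
  shows "insert x (underS \<kappa> x) \<in> null_sets M"
proof (rule null_small)
  show "|insert x (underS \<kappa> x)| <o \<kappa>"
    using assms by (intro card_insert_less card_of_underS[OF Card])
  show "insert x (underS \<kappa> x) \<subseteq> Field \<kappa>"
    using assms underS_Field by fastforce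
qed

text \<open>The image measure has only countably many points of positive mass. The remaining values
  number fewer than \<open>\<kappa>\<close> and have null fibres, so together they are
  negligible.\<close>

lemma countably_valued:
  fixes g :: "'k \<Rightarrow> 'j"
  assumes "|g ` Field \<kappa>| <o \<kappa>"
  obtains J where "countable J" "{x \<in> Field \<kappa>. g x \<notin> J} \<in> null_sets M"
proof
  have g: "g \<in> measurable M (count_space UNIV)"
    by (auto simp: measurable_def space_M)
  interpret N: prob_space "distr M (count_space UNIV) g"
    by (rule prob_space_distr[OF g])
  define J where "J = {j. measure (distr M (count_space UNIV) g) {j} \<noteq> 0}"
  show "countable J"
    unfolding J_def by (rule N.countable_support)
  have "{x \<in> Field \<kappa>. g x \<notin> J} = (\<Union>j\<in>g ` Field \<kappa> - J. g -` {j} \<inter> Field \<kappa>)"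
    by auto
  also have "\<dots> \<in> null_sets M"
  proof (rule null_UN)
    show "|g ` Field \<kappa> - J| <o \<kappa>"
      using assms by (rule card_mono_less) auto
    show "g -` {j} \<inter> Field \<kappa> \<in> null_sets M" if "j \<in> g ` Field \<kappa> - J" for j
      using that g by (auto simp: J_def measure_distr space_M null_sets_def emeasure_eq_measure)
  qed
  finally show "{x \<in> Field \<kappa>. g x \<notin> J} \<in> null_sets M" .
qed

text \<open>This is the null ideal of the completion of \<open>M\<close> restricted to the generated
  sigma-algebra. Initial segments are all null for \<open>M\<close>, but some will fail to lie in
  this smaller ideal.\<close>

definition gen_null :: "'k set set \<Rightarrow> 'k set set" where
  "gen_null \<E> = {S. \<exists>D \<in> sigma_sets (Field \<kappa>) \<E> \<inter> null_sets M. S \<subseteq> D}"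

lemma gen_null_subset: "S \<in> gen_null \<E> \<Longrightarrow> S' \<subseteq> S \<Longrightarrow> S' \<in> gen_null \<E>"
  unfolding gen_null_def by blast

lemma gen_null_imp_null: "S \<in> gen_null \<E> \<Longrightarrow> S \<in> null_sets M"
  unfolding gen_null_def using null_subset by blast

text \<open>
  Both variables cannot be treated symmetrically: \<open>i\<close> ranges over the total measure, and \<open>x\<close> only over the
  generated \<open>\<sigma>\<close>-algebra. Since \<open>|\<E>| <o \<kappa>\<close>, countably many generators suffice for almost all \<open>i\<close>, so the
  open covers of the sections \<open>C i\<close> form a countable union of rectangles, to which Tonelli applies.
\<close>

lemma gen_null_swap:
  assumes \<E>: "\<E> \<subseteq> Pow (Field \<kappa>)" "|\<E>| <o \<kappa>"
    and C: "\<And>i. i \<in> Field \<kappa> \<Longrightarrow> C i \<in> gen_null \<E>"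
  shows "{x \<in> Field \<kappa>. {i \<in> Field \<kappa>. x \<in> C i} \<notin> null_sets M} \<in> gen_null \<E>"
proof -
  have "\<exists>D. D \<in> sigma_sets (Field \<kappa>) \<E> \<and> D \<in> null_sets M \<and> C i \<subseteq> D" if "i \<in> Field \<kappa>" for i
    using C[OF that] unfolding gen_null_def by blast
  then obtain D where D: "\<And>i. i \<in> Field \<kappa> \<Longrightarrow> D i \<in> sigma_sets (Field \<kappa>) \<E>"
      "\<And>i. i \<in> Field \<kappa> \<Longrightarrow> D i \<in> null_sets M" "\<And>i. i \<in> Field \<kappa> \<Longrightarrow> C i \<subseteq> D i"
    by metis
  obtain \<C> where \<C>: "\<And>i. i \<in> Field \<kappa> \<Longrightarrow> countable (\<C> i)" "\<And>i. i \<in> Field \<kappa> \<Longrightarrow> \<C> i \<subseteq> \<E>"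
      "\<And>i. i \<in> Field \<kappa> \<Longrightarrow> D i \<in> sigma_sets (Field \<kappa>) (\<C> i)"
    using sigma_sets_countable_generators[OF D(1)] by metis
  \<comment> \<open>\<open>{}\<close> is added to make the family nonempty, so that
    \<open>from_nat_into\<close> runs through exactly this family.\<close>
  define e where "e i = from_nat_into (insert {} (\<C> i))" for i
  have e: "range (e i) = insert {} (\<C> i)" if "i \<in> Field \<kappa>" for i
    using \<C>(1)[OF that] unfolding e_def by (simp add: range_from_nat_into)
  \<comment> \<open>For fixed \<open>n\<close>, the \<open>n\<close>-th generator is a function of
    \<open>i\<close> with fewer than \<open>\<kappa>\<close> values, so it almost surely has one of
    countably many values.\<close>
  have "\<exists>J. countable J \<and> {i \<in> Field \<kappa>. e i n \<notin> J} \<in> null_sets M" for n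
  proof -
    have "e i n \<in> insert {} \<E>" if "i \<in> Field \<kappa>" for i
    proof -
      have "e i n \<in> insert {} (\<C> i)"
        using e[OF that] by blast
      then show ?thesis
        using \<C>(2)[OF that] by blast
    qed
    then have "(\<lambda>i. e i n) ` Field \<kappa> \<subseteq> insert {} \<E>"
      by (rule image_subsetI)
    then have "|(\<lambda>i. e i n) ` Field \<kappa>| <o \<kappa>"
      by (rule card_mono_less[OF card_insert_less[OF \<E>(2)]])
    then show ?thesis
      by (elim countably_valued) blast
  qed
  then obtain J where J: "\<And>n. countable (J n)" "\<And>n. {i \<in> Field \<kappa>. e i n \<notin> J n} \<in> null_sets M"
    by metis
  define K where "K = {i \<in> Field \<kappa>. \<forall>n. e i n \<in> J n}"
  have "Field \<kappa> - K = (\<Union>n. {i \<in> Field \<kappa>. e i n \<notin> J n})"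
    by (auto simp: K_def)
  then have K: "Field \<kappa> - K \<in> null_sets M"
    using null_sets_UN[OF J(2)] by simp
  define E where "E = from_nat_into (insert {} ((\<Union>n. J n) \<inter> \<E>))"
  have "countable (insert {} ((\<Union>n. J n) \<inter> \<E>))"
    using J(1) by auto
  then have E: "range E = insert {} ((\<Union>n. J n) \<inter> \<E>)"
    unfolding E_def by (simp add: range_from_nat_into)
  have DE: "D i \<in> sigma_sets (Field \<kappa>) (range E)" if "i \<in> K" for i
  proof -
    have i: "i \<in> Field \<kappa>" "range (e i) \<subseteq> (\<Union>n. J n)"
      using that unfolding K_def by blast+
    have "\<C> i \<subseteq> range (e i)"
      unfolding e[OF i(1)] by blast
    then have "\<C> i \<subseteq> (\<Union>n. J n)"
      using i(2) by (rule order_trans)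
    then have "\<C> i \<subseteq> range E"
      unfolding E using \<C>(2)[OF i(1)] by blast
    then show ?thesis
      using \<C>(3)[OF i(1)] by (rule subsetD[OF sigma_sets_mono'])
  qed
  let ?b = "bool_set (Field \<kappa>) E"
  have E_Pow: "range E \<subseteq> Pow (Field \<kappa>)"
    unfolding E using \<E>(1) by blast
  have b\<E>: "?b t \<in> sigma_sets (Field \<kappa>) \<E>" for t
  proof -
    have "sigma_sets (Field \<kappa>) (range E) \<subseteq> sigma_sets (Field \<kappa>) \<E>"
      unfolding E by (rule sigma_sets_mono) (auto intro: sigma_sets.Basic sigma_sets.Empty)
    then show ?thesis
      using bool_set_sigma[OF E_Pow] by (rule subsetD)
  qed
  have ex_T: "\<exists>T. D i \<subseteq> \<Union>(?b ` T) \<and> measure M (\<Union>(?b ` T)) < 1 / Suc k" if i: "i \<in> K" for k i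
  proof -
    obtain T where T: "D i \<subseteq> \<Union>(?b ` T)" "measure M (\<Union>(?b ` T) - D i) < 1 / Suc k"
      using sigma_sets_outer_approx[of "D i" E "1 / Suc k"] DE[OF i] E_Pow
      unfolding space_M sets_M by auto
    have "?b t \<subseteq> Field \<kappa>" for t
      using b\<E>[of t] \<E>(1) sigma_sets_into_sp by blast
    moreover have "D i \<in> null_sets M"
      using i D(2) by (auto simp: K_def)
    ultimately have "measure M (\<Union>(?b ` T) - D i) = measure M (\<Union>(?b ` T))"
      by (intro measure_Diff_null_set) auto
    with T show ?thesis by auto
  qed
  define T where "T k i = (SOME T. D i \<subseteq> \<Union>(?b ` T) \<and> measure M (\<Union>(?b ` T)) < 1 / Suc k)" for k i
  have "D i \<subseteq> \<Union>(?b ` T k i) \<and> measure M (\<Union>(?b ` T k i)) < 1 / Suc k" if "i \<in> K" for k i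
    unfolding T_def by (rule someI_ex[OF ex_T[OF that]])
  then have T: "\<And>k i. i \<in> K \<Longrightarrow> D i \<subseteq> \<Union>(?b ` T k i)"
      "\<And>k i. i \<in> K \<Longrightarrow> measure M (\<Union>(?b ` T k i)) < 1 / Suc k"
    by blast+
  \<comment> \<open>The second coordinate sees only generated sets. Hence the exceptional set of
    \<open>x\<close> is itself a generated set, not merely a null set of \<open>M\<close>.\<close>
  define N where "N = restr_to_subalg M (sigma (Field \<kappa>) \<E>)"
  have sub: "subalgebra M (sigma (Field \<kappa>) \<E>)"
    using \<E>(1) sigma_sets_into_sp[OF \<E>(1)] by (auto simp: subalgebra_def space_M)
  have sets_N: "sets N = sigma_sets (Field \<kappa>) \<E>"
    unfolding N_def sets_restr_to_subalg[OF sub] using \<E>(1) by simp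
  interpret N: prob_space N
    unfolding N_def by (rule prob_space_restr_to_subalg[OF sub prob_space_axioms])
  interpret pair_sigma_finite M N ..
  \<comment> \<open>The arbitrary choice of \<open>T\<close> does no harm: every set of indices
    \<open>i\<close> is measurable, and there are countably many codes \<open>t\<close>, so
    \<open>G k\<close> is a countable union of measurable rectangles.\<close>
  define G where "G k = (\<Union>t. {i \<in> K. t \<in> T k i} \<times> ?b t)" for k
  have G [measurable]: "G k \<in> sets (M \<Otimes>\<^sub>M N)" for k
    unfolding G_def using b\<E> by (intro sets.countable_UN') (auto simp: sets_N K_def)
  have emG: "emeasure (M \<Otimes>\<^sub>M N) (G k) \<le> ennreal (1 / Suc k)" for k
  proof -
    have "emeasure (M \<Otimes>\<^sub>M N) (G k) = (\<integral>\<^sup>+i. emeasure N (Pair i -` G k) \<partial>M)"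
      by (rule N.emeasure_pair_measure_alt[OF G])
    also have "\<dots> \<le> (\<integral>\<^sup>+i. ennreal (1 / Suc k) \<partial>M)"
    proof (rule nn_integral_mono)
      fix i
      have "Pair i -` G k \<in> sets N"
        by (rule sets_Pair1[OF G])
      then have "emeasure N (Pair i -` G k) = emeasure M (Pair i -` G k)"
        unfolding N_def by (intro emeasure_restr_to_subalg[OF sub]) (simp add: sets_restr_to_subalg[OF sub])
      also have "\<dots> \<le> ennreal (1 / Suc k)"
      proof (cases "i \<in> K")
        case True
        have "Pair i -` G k = \<Union>(?b ` T k i)"
          using True by (auto simp: G_def)
        then show ?thesis
          using T(2)[OF True, of k] by (simp add: emeasure_eq_measure)
      next
        case False
        then have "Pair i -` G k = {}" by (auto simp: G_def)
        then show ?thesis by simp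
      qed
      finally show "emeasure N (Pair i -` G k) \<le> ennreal (1 / Suc k)" .
    qed
    finally show ?thesis by (simp add: emeasure_space_1)
  qed
  \<comment> \<open>\<open>F x\<close> bounds the measure of the set of \<open>i\<close> in
    \<open>K\<close> with \<open>x\<close> in \<open>C i\<close>. Its integral is at most the
    measure of every \<open>G k\<close>, hence zero.\<close>
  define F where "F x = (INF k. emeasure M ((\<lambda>i. (i, x)) -` G k))" for x
  have F [measurable]: "F \<in> borel_measurable N"
    unfolding F_def by (intro borel_measurable_INF measurable_emeasure_Pair2 G) auto
  have "(\<integral>\<^sup>+x. F x \<partial>N) \<le> ennreal (1 / Suc k)" for k
  proof -
    have "(\<integral>\<^sup>+x. F x \<partial>N) \<le> (\<integral>\<^sup>+x. emeasure M ((\<lambda>i. (i, x)) -` G k) \<partial>N)"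
      by (intro nn_integral_mono) (auto simp: F_def intro: INF_lower)
    also have "\<dots> = emeasure (M \<Otimes>\<^sub>M N) (G k)"
      by (rule emeasure_pair_measure_alt2[OF G, symmetric])
    finally show ?thesis using emG order_trans by blast
  qed
  moreover have "(\<lambda>k. ennreal (1 / Suc k)) \<longlonglongrightarrow> ennreal 0"
    by (intro tendsto_ennrealI LIMSEQ_Suc lim_1_over_n)
  ultimately have "(\<integral>\<^sup>+x. F x \<partial>N) \<le> 0"
    by (intro LIMSEQ_le_const) auto
  then have "emeasure N {x \<in> space N. F x \<noteq> 0} = 0"
    using nn_integral_0_iff[OF F] by auto
  then have "{x \<in> space N. F x \<noteq> 0} \<in> null_sets N"
    by (intro null_setsI) auto
  then have Z: "{x \<in> Field \<kappa>. F x \<noteq> 0} \<in> sigma_sets (Field \<kappa>) \<E> \<inter> null_sets M"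
    unfolding N_def null_sets_restr_to_subalg[OF sub]
    using \<E>(1) by (simp add: space_restr_to_subalg space_M)
  have "{i \<in> Field \<kappa>. x \<in> C i} \<in> null_sets M" if x: "x \<in> Field \<kappa>" "F x = 0" for x
  proof -
    have "emeasure M {i \<in> K. x \<in> C i} \<le> F x"
      unfolding F_def
    proof (intro INF_greatest emeasure_mono)
      fix k
      show "{i \<in> K. x \<in> C i} \<subseteq> (\<lambda>i. (i, x)) -` G k"
        using T(1)[of _ k] D(3) by (fastforce simp: G_def K_def)
      show "(\<lambda>i. (i, x)) -` G k \<in> sets M"
        by (rule sets_Pair2[OF G])
    qed
    then have "{i \<in> K. x \<in> C i} \<in> null_sets M"
      using x by (intro null_setsI) (auto simp: K_def)
    then have "(Field \<kappa> - K) \<union> {i \<in> K. x \<in> C i} \<in> null_sets M"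
      using K by blast
    then show ?thesis
      by (rule null_subset) auto
  qed
  then have "{x \<in> Field \<kappa>. {i \<in> Field \<kappa>. x \<in> C i} \<notin> null_sets M} \<subseteq> {x \<in> Field \<kappa>. F x \<noteq> 0}"
    by blast
  with Z show ?thesis
    unfolding gen_null_def by blast
qed

text \<open>Each \<open>x\<close> in \<open>Q\<close> belongs to
  \<open>Q \<inter> underS \<kappa> i\<close> for all \<open>i\<close> above \<open>x\<close>, that
  is, for almost all \<open>i\<close>. If all these sets were generated null,
  \<open>gen_null_swap\<close> would make \<open>Q\<close> generated null too.\<close>

lemma initial_segment_not_gen_null:
  assumes \<E>: "\<E> \<subseteq> Pow (Field \<kappa>)" "|\<E>| <o \<kappa>"
    and Q: "Q \<subseteq> Field \<kappa>" "Q \<notin> null_sets M"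
  shows "\<exists>\<gamma>\<in>Field \<kappa>. Q \<inter> underS \<kappa> \<gamma> \<notin> gen_null \<E>"
proof (rule ccontr)
  assume "\<not> ?thesis"
  then have "Q \<inter> underS \<kappa> i \<in> gen_null \<E>" if "i \<in> Field \<kappa>" for i
    using that by blast
  then have "{x \<in> Field \<kappa>. {i \<in> Field \<kappa>. x \<in> Q \<inter> underS \<kappa> i} \<notin> null_sets M} \<in> gen_null \<E>"
    by (rule gen_null_swap[OF \<E>])
  moreover have "{i \<in> Field \<kappa>. x \<in> Q \<inter> underS \<kappa> i} \<notin> null_sets M" if x: "x \<in> Q" for x
  proof
    assume "{i \<in> Field \<kappa>. x \<in> Q \<inter> underS \<kappa> i} \<in> null_sets M"
    moreover have "insert x (underS \<kappa> x) \<in> null_sets M"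
      using x Q(1) by (intro null_insert_underS) auto
    ultimately have "{i \<in> Field \<kappa>. x \<in> Q \<inter> underS \<kappa> i} \<union> insert x (underS \<kappa> x) \<in> null_sets M"
      by (rule null_sets.Un)
    moreover have "Field \<kappa> \<subseteq> {i \<in> Field \<kappa>. x \<in> Q \<inter> underS \<kappa> i} \<union> insert x (underS \<kappa> x)"
    proof
      fix i assume "i \<in> Field \<kappa>"
      then show "i \<in> {i \<in> Field \<kappa>. x \<in> Q \<inter> underS \<kappa> i} \<union> insert x (underS \<kappa> x)"
        using in_underS_total[of i x] x Q(1) by auto
    qed
    ultimately show False
      using not_null_Field null_subset by blast
  qed
  then have "Q \<subseteq> {x \<in> Field \<kappa>. {i \<in> Field \<kappa>. x \<in> Q \<inter> underS \<kappa> i} \<notin> null_sets M}"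
    using Q(1) by blast
  ultimately have "Q \<in> gen_null \<E>"
    using gen_null_subset by blast
  with Q(2) gen_null_imp_null show False by blast
qed

end

section \<open>The measure is not generated by few sets\<close>

 

text \<open>Zorn's lemma applied to pairwise related subsets of \<open>S\<close>. Maximality is
  stated with both orders of \<open>R\<close> because a new element must be related to the old ones
  in both directions.\<close>

lemma maximal_pairwise:
  obtains H where "H \<subseteq> S" "pairwise R H"
    "\<And>h. h \<in> S \<Longrightarrow> (\<And>h'. h' \<in> H \<Longrightarrow> R h h' \<and> R h' h) \<Longrightarrow> h \<in> H"
proof -
  have "\<exists>H\<in>{H. H \<subseteq> S \<and> pairwise R H}. \<forall>G\<in>{H. H \<subseteq> S \<and> pairwise R H}. H \<subseteq> G \<longrightarrow> G = H"
  proof (rule subset_Zorn')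
    fix C assume C: "subset.chain {H. H \<subseteq> S \<and> pairwise R H} C"
    then have "pairwise R (\<Union>C)"
      by (intro pairwise_chain_Union) (auto simp: subset_chain_def chain_subset_def)
    with C show "\<Union>C \<in> {H. H \<subseteq> S \<and> pairwise R H}"
      by (auto simp: subset_chain_def)
  qed
  then obtain H where H: "H \<subseteq> S" "pairwise R H"
      "\<And>G. G \<subseteq> S \<Longrightarrow> pairwise R G \<Longrightarrow> H \<subseteq> G \<Longrightarrow> G = H"
    by auto
  have "h \<in> H" if "h \<in> S" "\<And>h'. h' \<in> H \<Longrightarrow> R h h' \<and> R h' h" for h
    using H(3)[of "insert h H"] that H(1,2) by (auto simp: pairwise_insert)
  with H(1,2) that show thesis by blast
qed

section \<open>A special case of the Gitik-Shelah theorem\<close>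

context real_valued_measure begin

text \<open>An unbounded \<open>A\<close> would cover \<open>Field \<kappa>\<close> by fewer than
  \<open>\<kappa>\<close> closed initial segments, each of which is null.\<close>

lemma small_bounded:
  assumes "A \<subseteq> Field \<kappa>" "|A| <o \<kappa>"
  shows "\<exists>\<beta>\<in>Field \<kappa>. A \<subseteq> underS \<kappa> \<beta>"
proof (rule ccontr)
  assume neg: "\<not> ?thesis"
  have "Field \<kappa> \<subseteq> (\<Union>a\<in>A. insert a (underS \<kappa> a))"
  proof
    fix x assume x: "x \<in> Field \<kappa>"
    then obtain a where "a \<in> A" "a \<notin> underS \<kappa> x"
      using neg by blast
    then show "x \<in> (\<Union>a\<in>A. insert a (underS \<kappa> a))"
      using in_underS_total[of a x] x assms(1) by blast
  qed
  moreover have "(\<Union>a\<in>A. insert a (underS \<kappa> a)) \<in> null_sets M"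
    using assms by (intro null_UN null_insert_underS) auto
  ultimately show False
    using not_null_Field null_subset by blast
qed

text \<open>Generated sets do not split a fibre, and by \<open>tr\<close> every set is generated up
  to a null set. A fibre of positive measure would therefore be an atom.\<close>

lemma fibre_null:
  assumes tr: "\<And>Q. Q \<subseteq> Field \<kappa> \<Longrightarrow> \<exists>D\<in>sigma_sets (Field \<kappa>) \<E>. sym_diff Q D \<in> null_sets M"
    and x: "x \<in> Field \<kappa>"
  shows "{y \<in> Field \<kappa>. {E \<in> \<E>. y \<in> E} = {E \<in> \<E>. x \<in> E}} \<in> null_sets M" (is "?F \<in> _")
proof (rule ccontr)
  assume "?F \<notin> null_sets M"
  then have "0 < measure M ?F"
    by (auto simp: null_sets_def emeasure_eq_measure zero_less_measure_iff)
  moreover have F: "?F \<in> sets M"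
    by auto
  ultimately obtain Y where Y: "Y \<subseteq> ?F" "0 < measure M Y" "measure M Y < measure M ?F"
    using atomless unfolding atomless_def by blast
  then have "Y \<subseteq> Field \<kappa>" by auto
  then obtain D where D: "D \<in> sigma_sets (Field \<kappa>) \<E>" "sym_diff Y D \<in> null_sets M"
    using tr by blast
  have side: "y \<in> D \<longleftrightarrow> x \<in> D" if "y \<in> ?F" for y
    using that x by (intro sigma_sets_same_side[OF D(1)]) auto
  show False
  proof (cases "x \<in> D")
    case True
    then have "?F - Y \<subseteq> sym_diff Y D"
      using side by blast
    then have "measure M (?F - Y) = 0"
      using null_subset[OF D(2)] measure_eq_0_null_sets by blast
    moreover have "measure M (?F - Y) = measure M ?F - measure M Y"
      using Y(1) \<open>Y \<subseteq> Field \<kappa>\<close> by (intro finite_measure_Diff) auto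
    ultimately show False using Y(3) by simp
  next
    case False
    then have "Y \<subseteq> sym_diff Y D"
      using side Y(1) by blast
    then have "measure M Y = 0"
      using null_subset[OF D(2)] measure_eq_0_null_sets by blast
    with Y(2) show False by simp
  qed
qed

text \<open>Diagonalize against a maximal family \<open>H\<close> enumerated by \<open>g\<close>. At
  \<open>x\<close> the new function avoids the classes of the fewer than \<open>\<kappa>\<close>
  values \<open>h' x\<close> with \<open>g h'\<close> below \<open>x\<close>, so it can agree with
  \<open>h'\<close> only up to the point \<open>g h'\<close>.\<close>

lemma large_apart_family:
  fixes w :: "'k \<Rightarrow> 'w"
  assumes w: "\<And>x. x \<in> Field \<kappa> \<Longrightarrow> {y \<in> Field \<kappa>. w y = w x} \<in> null_sets M"
  shows "\<exists>H. (\<forall>h\<in>H. h ` Field \<kappa> \<subseteq> Field \<kappa>) \<and>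
    pairwise (\<lambda>h h'. {x \<in> Field \<kappa>. w (h x) = w (h' x)} \<in> null_sets M) H \<and>
    \<not> |H| \<le>o |Field \<kappa>|"
proof -
  let ?R = "\<lambda>h h'. {x \<in> Field \<kappa>. w (h x) = w (h' x)} \<in> null_sets M"
  obtain H where H: "H \<subseteq> {h. h ` Field \<kappa> \<subseteq> Field \<kappa>}" "pairwise ?R H"
      "\<And>h. h \<in> {h. h ` Field \<kappa> \<subseteq> Field \<kappa>} \<Longrightarrow> (\<And>h'. h' \<in> H \<Longrightarrow> ?R h h' \<and> ?R h' h) \<Longrightarrow> h \<in> H"
    by (rule maximal_pairwise[of "{h. h ` Field \<kappa> \<subseteq> Field \<kappa>}" ?R]) blast
  have "\<not> |H| \<le>o |Field \<kappa>|"
  proof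
    assume "|H| \<le>o |Field \<kappa>|"
    then obtain g where g: "inj_on g H" "g ` H \<subseteq> Field \<kappa>"
      unfolding card_of_ordLeq[symmetric] by blast
    have ex: "\<exists>z. z \<in> Field \<kappa> \<and> (\<forall>h\<in>H. g h \<in> underS \<kappa> x \<longrightarrow> w z \<noteq> w (h x))"
      if x: "x \<in> Field \<kappa>" for x
    proof -
      let ?H = "{h \<in> H. g h \<in> underS \<kappa> x}"
      have "|?H| \<le>o |underS \<kappa> x|"
        using g(1) unfolding card_of_ordLeq[symmetric]
        by (intro exI[of _ g]) (auto intro: inj_on_subset)
      then have "|?H| <o \<kappa>"
        using card_of_underS[OF Card x] by (rule ordLeq_ordLess_trans)
      then have "(\<Union>h\<in>?H. {z \<in> Field \<kappa>. w z = w (h x)}) \<in> null_sets M"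
        using H(1) x by (intro null_UN w) auto
      then have "\<not> Field \<kappa> \<subseteq> (\<Union>h\<in>?H. {z \<in> Field \<kappa>. w z = w (h x)})"
        using not_null_Field null_subset by blast
      then show ?thesis by blast
    qed
    define h where "h x = (SOME z. z \<in> Field \<kappa> \<and> (\<forall>h\<in>H. g h \<in> underS \<kappa> x \<longrightarrow> w z \<noteq> w (h x)))" for x
    have h: "h x \<in> Field \<kappa> \<and> (\<forall>h'\<in>H. g h' \<in> underS \<kappa> x \<longrightarrow> w (h x) \<noteq> w (h' x))"
      if "x \<in> Field \<kappa>" for x
      unfolding h_def by (rule someI_ex[OF ex[OF that]])
    have R: "?R h h'" if h': "h' \<in> H" for h'
    proof (rule null_subset[OF null_insert_underS[of "g h'"]])
      show "g h' \<in> Field \<kappa>" using g(2) h' by blast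
      show "{x \<in> Field \<kappa>. w (h x) = w (h' x)} \<subseteq> insert (g h') (underS \<kappa> (g h'))"
      proof
        fix x assume "x \<in> {x \<in> Field \<kappa>. w (h x) = w (h' x)}"
        then have x: "x \<in> Field \<kappa>" "w (h x) = w (h' x)" by auto
        then have "g h' \<notin> underS \<kappa> x"
          using h[OF x(1)] h' by blast
        then show "x \<in> insert (g h') (underS \<kappa> (g h'))"
          using in_underS_total[OF \<open>g h' \<in> Field \<kappa>\<close> x(1)] by blast
      qed
    qed
    have "h \<in> H"
    proof (rule H(3))
      show "h \<in> {h. h ` Field \<kappa> \<subseteq> Field \<kappa>}" using h by blast
      show "?R h h' \<and> ?R h' h" if "h' \<in> H" for h'
        using R[OF that] by (simp add: eq_commute)
    qed
    \<comment> \<open>By maximality \<open>h\<close> is a member of \<open>H\<close>, so it would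
      differ from itself almost everywhere.\<close>
    from R[OF this] show False
      using not_null_Field by simp
  qed
  with H(1,2) show ?thesis by blast
qed

lemma not_small_generated:
  assumes \<E>: "\<E> \<subseteq> Pow (Field \<kappa>)" "|\<E>| <o \<kappa>"
    and tr: "\<And>Q. Q \<subseteq> Field \<kappa> \<Longrightarrow> \<exists>D\<in>sigma_sets (Field \<kappa>) \<E>. sym_diff Q D \<in> null_sets M"
  shows False
proof -
  \<comment> \<open>Points are coded by the generators that contain them, and functions are compared
    through the codes of their values, which generated sets can approximate.\<close>
  define w where "w x = {E \<in> \<E>. x \<in> E}" for x
  have w: "{y \<in> Field \<kappa>. w y = w x} \<in> null_sets M" if "x \<in> Field \<kappa>" for x
    unfolding w_def by (rule fibre_null[OF tr that])
  obtain H where H: "\<And>h. h \<in> H \<Longrightarrow> h ` Field \<kappa> \<subseteq> Field \<kappa>"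
      "pairwise (\<lambda>h h'. {x \<in> Field \<kappa>. w (h x) = w (h' x)} \<in> null_sets M) H"
      "\<not> |H| \<le>o |Field \<kappa>|"
    using large_apart_family[of w, OF w] by blast
  define D where "D h E = (SOME D. D \<in> sigma_sets (Field \<kappa>) \<E> \<and>
      sym_diff {x \<in> Field \<kappa>. h x \<in> E} D \<in> null_sets M)" for h :: "'k \<Rightarrow> 'k" and E
  have D: "D h E \<in> sigma_sets (Field \<kappa>) \<E>" "sym_diff {x \<in> Field \<kappa>. h x \<in> E} (D h E) \<in> null_sets M" for h E
  proof -
    have "\<exists>D. D \<in> sigma_sets (Field \<kappa>) \<E> \<and> sym_diff {x \<in> Field \<kappa>. h x \<in> E} D \<in> null_sets M"
      using tr[of "{x \<in> Field \<kappa>. h x \<in> E}"] by blast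
    from someI_ex[OF this] show "D h E \<in> sigma_sets (Field \<kappa>) \<E>"
        "sym_diff {x \<in> Field \<kappa>. h x \<in> E} (D h E) \<in> null_sets M"
      unfolding D_def by blast+
  qed
  \<comment> \<open>\<open>\<phi> h x\<close> is the code that generated sets predict for
    \<open>h x\<close>. One null set per generator has to be discarded for the prediction to be
    right, and this is still a null set.\<close>
  define \<phi> where "\<phi> h x = {E \<in> \<E>. x \<in> D h E}" for h x
  define Q where "Q h = {x \<in> Field \<kappa>. \<phi> h x = w (h x)}" for h
  have Q: "Field \<kappa> - Q h \<in> null_sets M" for h
  proof (rule null_subset)
    show "(\<Union>E\<in>\<E>. sym_diff {x \<in> Field \<kappa>. h x \<in> E} (D h E)) \<in> null_sets M"
      by (intro null_UN \<E>(2) D)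
    show "Field \<kappa> - Q h \<subseteq> (\<Union>E\<in>\<E>. sym_diff {x \<in> Field \<kappa>. h x \<in> E} (D h E))"
      by (auto simp: Q_def \<phi>_def w_def)
  qed
  have agree: "{x \<in> Field \<kappa>. \<phi> h x = \<phi> h' x} \<in> gen_null \<E>" if h: "h \<in> H" "h' \<in> H" "h \<noteq> h'" for h h'
  proof -
    define S where "S E = sym_diff (D h E) (D h' E)" for E
    interpret sg: sigma_algebra "Field \<kappa>" "sigma_sets (Field \<kappa>) \<E>"
      by (rule sigma_algebra_sigma_sets[OF \<E>(1)])
    have S: "S E \<in> sigma_sets (Field \<kappa>) \<E>" for E
      unfolding S_def by (intro sg.Un sg.Diff D)
    \<comment> \<open>\<open>j x\<close> is a generator witnessing that the two predictions differ
      at \<open>x\<close>, with \<open>{}\<close> as default. By \<open>countably_valued\<close>,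
      countably many witnesses suffice almost everywhere, so \<open>?D\<close> below is a generated
      set although \<open>\<E>\<close> may be uncountable.\<close>
    define j where "j x = (if \<exists>E\<in>\<E>. x \<in> S E then SOME E. E \<in> \<E> \<and> x \<in> S E else {})" for x
    have j: "j x \<in> \<E> \<and> x \<in> S (j x)" if "E \<in> \<E>" "x \<in> S E" for x E
    proof -
      have "\<exists>E. E \<in> \<E> \<and> x \<in> S E" using that by blast
      from someI_ex[OF this] show ?thesis
        using that unfolding j_def by auto
    qed
    have "j x \<in> insert {} \<E>" for x
    proof (cases "\<exists>E\<in>\<E>. x \<in> S E")
      case True
      then show ?thesis using j by blast
    next
      case False
      then show ?thesis by (simp add: j_def)
    qed
    then have "j ` Field \<kappa> \<subseteq> insert {} \<E>"
      by blast
    then have "|j ` Field \<kappa>| <o \<kappa>"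
      by (rule card_mono_less[OF card_insert_less[OF \<E>(2)]])
    then obtain J where J: "countable J" "{x \<in> Field \<kappa>. j x \<notin> J} \<in> null_sets M"
      by (rule countably_valued)
    let ?D = "Field \<kappa> - (\<Union>E\<in>J \<inter> \<E>. S E)"
    have "(\<Union>E\<in>J \<inter> \<E>. S E) \<in> sigma_sets (Field \<kappa>) \<E>"
      using S J(1) by (intro sg.countable_UN') auto
    then have "?D \<in> sigma_sets (Field \<kappa>) \<E>"
      by (rule sg.compl_sets)
    moreover have "?D \<in> null_sets M"
    proof (rule null_subset)
      show "(Field \<kappa> - Q h) \<union> (Field \<kappa> - Q h') \<union> {x \<in> Field \<kappa>. w (h x) = w (h' x)}
          \<union> {x \<in> Field \<kappa>. j x \<notin> J} \<in> null_sets M"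
        using Q J(2) pairwiseD[OF H(2) h] by (intro null_sets.Un)
      show "?D \<subseteq> (Field \<kappa> - Q h) \<union> (Field \<kappa> - Q h') \<union> {x \<in> Field \<kappa>. w (h x) = w (h' x)}
          \<union> {x \<in> Field \<kappa>. j x \<notin> J}"
      proof
        fix x assume x: "x \<in> ?D"
        have "x \<in> Q h \<Longrightarrow> x \<in> Q h' \<Longrightarrow> j x \<in> J \<Longrightarrow> w (h x) = w (h' x)"
        proof (rule ccontr)
          assume *: "x \<in> Q h" "x \<in> Q h'" "j x \<in> J" "w (h x) \<noteq> w (h' x)"
          then have "\<phi> h x \<noteq> \<phi> h' x" by (simp add: Q_def)
          then obtain E where "E \<in> \<E>" "x \<in> S E"
            unfolding \<phi>_def S_def by blast
          from j[OF this] x *(3) show False by blast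
        qed
        with x show "x \<in> (Field \<kappa> - Q h) \<union> (Field \<kappa> - Q h') \<union> {x \<in> Field \<kappa>. w (h x) = w (h' x)}
          \<union> {x \<in> Field \<kappa>. j x \<notin> J}"
          by blast
      qed
    qed
    moreover have "{x \<in> Field \<kappa>. \<phi> h x = \<phi> h' x} \<subseteq> ?D"
      unfolding \<phi>_def S_def by blast
    ultimately show ?thesis
      unfolding gen_null_def by blast
  qed
  have ex_bounds: "\<exists>p. fst p \<in> Field \<kappa> \<and> snd p \<in> Field \<kappa> \<and> Q h \<inter> underS \<kappa> (fst p) \<notin> gen_null \<E> \<and>
      h ` underS \<kappa> (fst p) \<subseteq> underS \<kappa> (snd p)" if h: "h \<in> H" for h
  proof -
    have "Q h \<notin> null_sets M"
    proof
      assume "Q h \<in> null_sets M"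
      then have "Q h \<union> (Field \<kappa> - Q h) \<in> null_sets M"
        using Q by (rule null_sets.Un)
      then show False
        using not_null_Field null_subset by blast
    qed
    then obtain \<gamma> where \<gamma>: "\<gamma> \<in> Field \<kappa>" "Q h \<inter> underS \<kappa> \<gamma> \<notin> gen_null \<E>"
      using initial_segment_not_gen_null[OF \<E>, of "Q h"] unfolding Q_def by blast
    have "h ` underS \<kappa> \<gamma> \<subseteq> Field \<kappa>"
      by (rule order_trans[OF image_mono[OF subsetI[OF underS_Field]] H(1)[OF h]])
    moreover have "|h ` underS \<kappa> \<gamma>| <o \<kappa>"
      using card_of_image card_of_underS[OF Card \<gamma>(1)] by (rule ordLeq_ordLess_trans)
    ultimately obtain \<beta> where "\<beta> \<in> Field \<kappa>" "h ` underS \<kappa> \<gamma> \<subseteq> underS \<kappa> \<beta>"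
      using small_bounded by blast
    with \<gamma> show ?thesis by (intro exI[of _ "(\<gamma>, \<beta>)"]) simp
  qed
  define b where "b h = (SOME p. fst p \<in> Field \<kappa> \<and> snd p \<in> Field \<kappa> \<and>
      Q h \<inter> underS \<kappa> (fst p) \<notin> gen_null \<E> \<and> h ` underS \<kappa> (fst p) \<subseteq> underS \<kappa> (snd p))" for h
  have b: "fst (b h) \<in> Field \<kappa> \<and> snd (b h) \<in> Field \<kappa> \<and>
      Q h \<inter> underS \<kappa> (fst (b h)) \<notin> gen_null \<E> \<and> h ` underS \<kappa> (fst (b h)) \<subseteq> underS \<kappa> (snd (b h))"
    if "h \<in> H" for h
    unfolding b_def by (rule someI_ex[OF ex_bounds[OF that]])
  \<comment> \<open>Pigeonhole: there are only as many pairs as elements of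
    \<open>Field \<kappa>\<close>, while \<open>H\<close> is larger.\<close>
  have "\<exists>p\<in>Field \<kappa> \<times> Field \<kappa>. \<not> |{h \<in> H. b h = p}| \<le>o |Field \<kappa>|"
  proof (rule ccontr)
    assume "\<not> ?thesis"
    then have "|\<Union>p\<in>Field \<kappa> \<times> Field \<kappa>. {h \<in> H. b h = p}| \<le>o |Field \<kappa>|"
      using infinite_Field
      by (intro card_of_UNION_ordLeq_infinite ordIso_imp_ordLeq card_of_Times_same_infinite) auto
    moreover have "H = (\<Union>p\<in>Field \<kappa> \<times> Field \<kappa>. {h \<in> H. b h = p})"
    proof
      show "H \<subseteq> (\<Union>p\<in>Field \<kappa> \<times> Field \<kappa>. {h \<in> H. b h = p})"
        using b by (auto simp: mem_Times_iff)
    qed auto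
    ultimately show False using H(3) by simp
  qed
  then obtain p where p: "p \<in> Field \<kappa> \<times> Field \<kappa>" "\<not> |{h \<in> H. b h = p}| \<le>o |Field \<kappa>|"
    by blast
  then have "|Field \<kappa>| \<le>o |{h \<in> H. b h = p}|"
    by (simp add: not_ordLeq_iff_ordLess card_of_Well_order ordLess_imp_ordLeq)
  then obtain e where e: "inj_on e (Field \<kappa>)" "e ` Field \<kappa> \<subseteq> {h \<in> H. b h = p}"
    unfolding card_of_ordLeq[symmetric] by blast
  define \<gamma> \<beta> where "\<gamma> = fst p" and "\<beta> = snd p"
  have \<gamma>\<beta>: "\<gamma> \<in> Field \<kappa>" "\<beta> \<in> Field \<kappa>"
    using p(1) by (auto simp: \<gamma>_def \<beta>_def)
  have eH: "e i \<in> H" and e1: "Q (e i) \<inter> underS \<kappa> \<gamma> \<notin> gen_null \<E>"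
    and e2: "e i ` underS \<kappa> \<gamma> \<subseteq> underS \<kappa> \<beta>" if i: "i \<in> Field \<kappa>" for i
  proof -
    have *: "e i \<in> H" "b (e i) = p"
      using e(2) i by auto
    show "e i \<in> H" by fact
    show "Q (e i) \<inter> underS \<kappa> \<gamma> \<notin> gen_null \<E>" "e i ` underS \<kappa> \<gamma> \<subseteq> underS \<kappa> \<beta>"
      using b[OF *(1)] unfolding *(2) \<gamma>_def \<beta>_def by blast+
  qed
  define I where "I y c = {i \<in> Field \<kappa>. \<phi> (e i) y = w c}" for y c
  \<comment> \<open>Only the null sets \<open>I y c\<close> enter this union. If an \<open>i\<close>
    outside it lies in some \<open>I y c\<close> with \<open>y\<close> and \<open>c\<close> below
    the bounds, then that set is nonnull.\<close>
  have "(\<Union>y\<in>underS \<kappa> \<gamma>. \<Union>c\<in>underS \<kappa> \<beta>. if I y c \<in> null_sets M then I y c else {}) \<in> null_sets M" (is "?N \<in> _")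
    by (intro null_UN card_of_underS Card \<gamma>\<beta>) simp
  then have "\<not> Field \<kappa> \<subseteq> ?N"
    using not_null_Field null_subset by blast
  then obtain i where i: "i \<in> Field \<kappa>" "i \<notin> ?N"
    by blast
  \<comment> \<open>At \<open>i\<close> itself the agreement set would be everything, hence the
    value \<open>{}\<close>; losing a single index costs a null set.\<close>
  define C where "C i' = (if i' = i then {} else {x \<in> Field \<kappa>. \<phi> (e i) x = \<phi> (e i') x})" for i'
  have "C i' \<in> gen_null \<E>" if i': "i' \<in> Field \<kappa>" for i'
  proof (cases "i' = i")
    case True
    then show ?thesis
      unfolding C_def gen_null_def by (auto intro: sigma_sets.Empty)
  next
    case False
    then have "e i \<noteq> e i'"
      using e(1) i(1) i' by (auto dest: inj_onD)
    with False show ?thesis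
      using agree[OF eH[OF i(1)] eH[OF i']] by (simp add: C_def)
  qed
  then have "{x \<in> Field \<kappa>. {i' \<in> Field \<kappa>. x \<in> C i'} \<notin> null_sets M} \<in> gen_null \<E>"
    by (rule gen_null_swap[OF \<E>])
  moreover have "Q (e i) \<inter> underS \<kappa> \<gamma> \<subseteq> {x \<in> Field \<kappa>. {i' \<in> Field \<kappa>. x \<in> C i'} \<notin> null_sets M}"
  proof
    fix y assume "y \<in> Q (e i) \<inter> underS \<kappa> \<gamma>"
    then have y: "y \<in> Field \<kappa>" "\<phi> (e i) y = w (e i y)" "y \<in> underS \<kappa> \<gamma>"
      by (auto simp: Q_def)
    then have c: "e i y \<in> underS \<kappa> \<beta>"
      using e2[OF i(1)] by blast
    have "i \<in> I y (e i y)"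
      using y(2) i(1) by (simp add: I_def)
    then have "I y (e i y) \<notin> null_sets M"
      using i(2) y(3) c by auto
    \<comment> \<open>As \<open>y\<close> lies in \<open>Q (e i)\<close>, the code of
      \<open>e i y\<close> is \<open>\<phi> (e i) y\<close>. The other indices in
      \<open>I y (e i y)\<close> are thus those whose prediction at \<open>y\<close> agrees with
      that of \<open>e i\<close>.\<close>
    moreover have "I y (e i y) \<subseteq> insert i {i' \<in> Field \<kappa>. y \<in> C i'}"
      using y by (auto simp: I_def C_def)
    moreover have "insert i {i' \<in> Field \<kappa>. y \<in> C i'} \<in> null_sets M" if "{i' \<in> Field \<kappa>. y \<in> C i'} \<in> null_sets M"
      using null_sets.Un[OF null_singleton[OF i(1)] that] by simp
    ultimately show "y \<in> {x \<in> Field \<kappa>. {i' \<in> Field \<kappa>. x \<in> C i'} \<notin> null_sets M}"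
      using y(1) null_subset by blast
  qed
  ultimately have "Q (e i) \<inter> underS \<kappa> \<gamma> \<in> gen_null \<E>"
    by (rule gen_null_subset)
  with e1[OF i(1)] show False by simp
qed

end

section \<open>Maharam's lemma\<close>

text \<open>Hahn decomposition of two densities restricted to \<open>F\<close>. It stands in for
  conditional expectations: \<open>Y\<close> is where the conditional probability of
  \<open>Q\<close> given \<open>F\<close> is at most \<open>c\<close> times that of
  \<open>P\<close>.\<close>

lemma (in finite_measure) sub_Hahn_decomposition:
  assumes sub: "subalgebra M F" and [measurable]: "P \<in> sets M" "Q \<in> sets M" and "0 \<le> c"
  obtains Y where "Y \<in> sets F"
    "\<And>A. A \<in> sets F \<Longrightarrow> A \<subseteq> Y \<Longrightarrow> measure M (Q \<inter> A) \<le> c * measure M (P \<inter> A)"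
    "\<And>A. A \<in> sets F \<Longrightarrow> A \<inter> Y = {} \<Longrightarrow> c * measure M (P \<inter> A) \<le> measure M (Q \<inter> A)"
proof -
  define R where "R d S = restr_to_subalg (density M (\<lambda>x. ennreal d * indicator S x)) F" for d S
  have sub': "subalgebra (density M (\<lambda>x. ennreal d * indicator S x)) F" for d S
    using sub by (simp add: subalgebra_def)
  have sets_R: "sets (R d S) = sets F" for d S
    unfolding R_def by (rule sets_restr_to_subalg[OF sub'])
  have em: "emeasure (R d S) A = ennreal (d * measure M (S \<inter> A))"
    if "A \<in> sets F" "S \<in> sets M" "0 \<le> d" for d S A
  proof -
    have A: "A \<in> sets M" using that sub by (auto simp: subalgebra_def)
    have "emeasure (R d S) A = emeasure (density M (\<lambda>x. ennreal d * indicator S x)) A"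
      unfolding R_def by (rule emeasure_restr_to_subalg[OF sub' that(1)])
    also have "\<dots> = (\<integral>\<^sup>+x. ennreal d * indicator (S \<inter> A) x \<partial>M)"
      using A that(2) by (subst emeasure_density) (auto simp: indicator_inter_arith mult.assoc)
    also have "\<dots> = ennreal d * emeasure M (S \<inter> A)"
      using A that(2) by (intro nn_integral_cmult_indicator) auto
    finally show ?thesis
      using that(3) by (simp add: emeasure_eq_measure ennreal_mult)
  qed
  have fin: "finite_measure (R d S)" if "S \<in> sets M" "0 \<le> d" for d S
  proof
    have "space (R d S) \<in> sets F" using sets.top[of "R d S"] sets_R by simp
    then show "emeasure (R d S) (space (R d S)) \<noteq> \<infinity>"
      using em that by simp
  qed
  obtain Y where Y: "Y \<in> sets (R c P)"
      "\<forall>X\<in>sets (R c P). X \<subseteq> Y \<longrightarrow> emeasure (R 1 Q) X \<le> emeasure (R c P) X"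
      "\<forall>X\<in>sets (R c P). X \<inter> Y = {} \<longrightarrow> emeasure (R c P) X \<le> emeasure (R 1 Q) X"
    using finite_unsigned_Hahn_decomposition[OF fin[of P c] fin[of Q 1]] assms(2-4) sets_R by auto
  show thesis
  proof
    show "Y \<in> sets F" using Y(1) sets_R by simp
    show "measure M (Q \<inter> A) \<le> c * measure M (P \<inter> A)" if "A \<in> sets F" "A \<subseteq> Y" for A
      using Y(2) that sets_R em[of A P c] em[of A Q 1] assms(2-4) by (auto simp: ennreal_le_iff)
    show "c * measure M (P \<inter> A) \<le> measure M (Q \<inter> A)" if "A \<in> sets F" "A \<inter> Y = {}" for A
      using Y(3) that sets_R em[of A P c] em[of A Q 1] assms(2-4) by (auto simp: ennreal_le_iff)
  qed
qed

text \<open>Build a chain whose next member comes within \<open>1 / Suc n\<close> of the supremum of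
  the measures still reachable. An extension of the union extends every stage, so it gains
  nothing.\<close>

lemma (in finite_measure) exhaustion:
  assumes "E0 \<in> \<G>" "\<G> \<subseteq> sets M"
    and UN: "\<And>E. (\<And>n::nat. E n \<in> \<G>) \<Longrightarrow> incseq E \<Longrightarrow> (\<Union>n. E n) \<in> \<G>"
  shows "\<exists>E\<in>\<G>. \<forall>E'\<in>\<G>. E \<subseteq> E' \<longrightarrow> measure M E' \<le> measure M E"
proof -
  define s where "s E = (SUP E'\<in>{E'\<in>\<G>. E \<subseteq> E'}. measure M E')" for E
  have bdd: "bdd_above (measure M ` {E'\<in>\<G>. E \<subseteq> E'})" for E
    by (intro bdd_aboveI[of _ "measure M (space M)"]) (auto intro: bounded_measure)
  have "\<exists>E'. E' \<in> \<G> \<and> E \<subseteq> E' \<and> s E - 1 / Suc n < measure M E'" if "E \<in> \<G>" for E n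
  proof -
    have "s E - 1 / Suc n < s E" by simp
    then show ?thesis
      unfolding s_def using that bdd[of E] by (subst (asm) less_cSUP_iff) auto
  qed
  then obtain E where E: "\<And>n. E n \<in> \<G>" "\<And>n. E n \<subseteq> E (Suc n)"
      "\<And>n. s (E n) - 1 / Suc n < measure M (E (Suc n))"
    using dependent_nat_choice[of "\<lambda>_ E. E \<in> \<G>" "\<lambda>n E E'. E \<subseteq> E' \<and> s E - 1 / Suc n < measure M E'"]
      assms(1) by metis
  have inc: "incseq E" using E(2) by (rule incseq_SucI)
  have U: "(\<Union>n. E n) \<in> \<G>" by (rule UN[OF E(1) inc])
  have "measure M E' \<le> measure M (\<Union>n. E n)" if E': "E' \<in> \<G>" "(\<Union>n. E n) \<subseteq> E'" for E'
  proof (rule LIMSEQ_le_const)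
    show "(\<lambda>n. measure M (\<Union>n. E n) + 1 / Suc n) \<longlonglongrightarrow> measure M (\<Union>n. E n)"
      using tendsto_add[OF tendsto_const LIMSEQ_Suc[OF lim_1_over_n], of "measure M (\<Union>n. E n)"] by simp
    have "measure M E' \<le> measure M (\<Union>n. E n) + 1 / Suc n" for n
    proof -
      have "measure M E' \<le> s (E n)"
        unfolding s_def using E' by (intro cSUP_upper bdd) auto
      also have "\<dots> \<le> measure M (E (Suc n)) + 1 / Suc n"
        using E(3)[of n] by simp
      also have "measure M (E (Suc n)) \<le> measure M (\<Union>n. E n)"
        using U assms(2) by (intro finite_measure_mono) auto
      finally show ?thesis by simp
    qed
    then show "\<exists>N. \<forall>n\<ge>N. measure M E' \<le> measure M (\<Union>n. E n) + 1 / Suc n" by blast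
  qed
  with U show ?thesis by blast
qed

text \<open>Maharam's lemma: \<open>split\<close> says that on no set of positive measure does
  \<open>F\<close> give everything up to null sets. Take a maximal set of conditional probability at
  most 1/2 given \<open>F\<close>; if it stayed below 1/2 somewhere, a set of tiny conditional
  probability could be added there.\<close>

lemma (in prob_space) relatively_independent_half:
  assumes sub: "subalgebra M F"
    and split: "\<And>P. P \<in> sets M \<Longrightarrow> 0 < measure M P \<Longrightarrow>
      \<exists>Q\<in>sets M. Q \<subseteq> P \<and> (\<forall>D\<in>sets F. 0 < measure M (sym_diff Q (D \<inter> P)))"
  shows "\<exists>E\<in>sets M. \<forall>A\<in>sets F. measure M (E \<inter> A) = measure M A / 2"
proof -
  have F [measurable_dest]: "A \<in> sets M" if "A \<in> sets F" for A
    using that sub by (auto simp: subalgebra_def)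
  have sF: "space F = space M" using sub by (simp add: subalgebra_def)
  \<comment> \<open>Split \<open>P\<close> nontrivially into \<open>Q\<close> and \<open>P - Q\<close>, and take from each the part where its conditional probability is the smaller one.\<close>
  have halve: "\<exists>P'\<in>sets M. P' \<subseteq> P \<and> 0 < measure M P' \<and> (\<forall>A\<in>sets F. measure M (P' \<inter> A) \<le> 1/2 * measure M (P \<inter> A))"
    if P: "P \<in> sets M" "0 < measure M P" for P
  proof -
    obtain Q where Q: "Q \<in> sets M" "Q \<subseteq> P" "\<And>D. D \<in> sets F \<Longrightarrow> 0 < measure M (sym_diff Q (D \<inter> P))"
      using split[OF P] by blast
    obtain Y where Y: "Y \<in> sets F"
        "\<And>A. A \<in> sets F \<Longrightarrow> A \<subseteq> Y \<Longrightarrow> measure M (Q \<inter> A) \<le> 1/2 * measure M (P \<inter> A)"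
        "\<And>A. A \<in> sets F \<Longrightarrow> A \<inter> Y = {} \<Longrightarrow> 1/2 * measure M (P \<inter> A) \<le> measure M (Q \<inter> A)"
      using sub_Hahn_decomposition[OF sub P(1) Q(1), of "1/2"] by auto
    define P' where "P' = (Q \<inter> Y) \<union> ((P - Q) - Y)"
    have "P' = sym_diff Q ((space F - Y) \<inter> P)"
      using Q(2) sets.sets_into_space[OF P(1)] by (auto simp: P'_def sF)
    then have "0 < measure M P'"
      using Q(3)[of "space F - Y"] Y(1) by auto
    moreover have "measure M (P' \<inter> A) \<le> 1/2 * measure M (P \<inter> A)" if A: "A \<in> sets F" for A
    proof -
      have [measurable]: "A \<in> sets M" "Y \<in> sets M" "P \<in> sets M" "Q \<in> sets M"
        using A Y(1) F P(1) Q(1) by auto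
      have "measure M (P' \<inter> A) = measure M (Q \<inter> (A \<inter> Y)) + measure M ((P - Q) \<inter> (A - Y))"
        unfolding P'_def by (subst finite_measure_Union[symmetric]) (auto intro!: arg_cong[where f="measure M"])
      moreover have "measure M ((P - Q) \<inter> (A - Y)) = measure M (P \<inter> (A - Y)) - measure M (Q \<inter> (A - Y))"
        using Q(2) by (subst finite_measure_Diff[symmetric]) (auto intro!: arg_cong[where f="measure M"])
      moreover have "measure M (Q \<inter> (A \<inter> Y)) \<le> 1/2 * measure M (P \<inter> (A \<inter> Y))"
        using A Y(1) by (intro Y(2)) auto
      moreover have "1/2 * measure M (P \<inter> (A - Y)) \<le> measure M (Q \<inter> (A - Y))"
        using A Y(1) by (intro Y(3)) auto
      moreover have "measure M (P \<inter> A) = measure M (P \<inter> (A \<inter> Y)) + measure M (P \<inter> (A - Y))"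
        by (subst finite_measure_Union[symmetric]) (auto intro!: arg_cong[where f="measure M"])
      ultimately show ?thesis by simp
    qed
    moreover have "P' \<in> sets M" "P' \<subseteq> P"
      using P(1) Q(1,2) Y(1) F by (auto simp: P'_def)
    ultimately show ?thesis by blast
  qed
  have small: "\<exists>P'\<in>sets M. P' \<subseteq> P \<and> 0 < measure M P' \<and> (\<forall>A\<in>sets F. measure M (P' \<inter> A) \<le> (1/2)^n * measure M (P \<inter> A))"
    if P: "P \<in> sets M" "0 < measure M P" for P n
  proof (induction n)
    case 0
    then show ?case using P by auto
  next
    case (Suc n)
    then obtain P1 where P1: "P1 \<in> sets M" "P1 \<subseteq> P" "0 < measure M P1"
        "\<And>A. A \<in> sets F \<Longrightarrow> measure M (P1 \<inter> A) \<le> (1/2)^n * measure M (P \<inter> A)"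
      by blast
    then obtain P2 where P2: "P2 \<in> sets M" "P2 \<subseteq> P1" "0 < measure M P2"
        "\<And>A. A \<in> sets F \<Longrightarrow> measure M (P2 \<inter> A) \<le> 1/2 * measure M (P1 \<inter> A)"
      using halve[of P1] by blast
    have "measure M (P2 \<inter> A) \<le> (1/2)^Suc n * measure M (P \<inter> A)" if "A \<in> sets F" for A
      using P1(4)[OF that] P2(4)[OF that] by simp
    then show ?case using P1 P2 by blast
  qed
  define \<G> where "\<G> = {E \<in> sets M. \<forall>A\<in>sets F. measure M (E \<inter> A) \<le> measure M A / 2}"
  have "\<exists>E\<in>\<G>. \<forall>E'\<in>\<G>. E \<subseteq> E' \<longrightarrow> measure M E' \<le> measure M E"
  proof (rule exhaustion[of "{}"])
    fix E :: "nat \<Rightarrow> 'a set" assume E: "\<And>n. E n \<in> \<G>" "incseq E"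
    have "measure M ((\<Union>n. E n) \<inter> A) \<le> measure M A / 2" if A: "A \<in> sets F" for A
    proof (rule LIMSEQ_le_const2)
      have "(\<lambda>n. measure M (E n \<inter> A)) \<longlonglongrightarrow> measure M (\<Union>n. E n \<inter> A)"
        using E A F by (intro finite_Lim_measure_incseq) (fastforce simp: \<G>_def incseq_def)+
      then show "(\<lambda>n. measure M (E n \<inter> A)) \<longlonglongrightarrow> measure M ((\<Union>n. E n) \<inter> A)"
        by (simp add: Int_UN_distrib2)
      show "\<exists>N. \<forall>n\<ge>N. measure M (E n \<inter> A) \<le> measure M A / 2"
        using E(1) A by (auto simp: \<G>_def)
    qed
    then show "(\<Union>n. E n) \<in> \<G>"
      using E(1) by (auto simp: \<G>_def)
  qed (auto simp: \<G>_def)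
  then obtain E where E: "E \<in> \<G>" "\<And>E'. E' \<in> \<G> \<Longrightarrow> E \<subseteq> E' \<Longrightarrow> measure M E' \<le> measure M E"
    by blast
  then have [measurable]: "E \<in> sets M" and E_le: "\<And>A. A \<in> sets F \<Longrightarrow> measure M (E \<inter> A) \<le> measure M A / 2"
    by (auto simp: \<G>_def)
  have "measure M (E \<inter> A) = measure M A / 2" if A: "A \<in> sets F" for A
  proof (rule ccontr)
    assume "measure M (E \<inter> A) \<noteq> measure M A / 2"
    then have less: "measure M (E \<inter> A) < measure M A / 2"
      using E_le[OF A] by simp
    then have A0: "0 < measure M A"
      using measure_nonneg[of M "E \<inter> A"] by linarith
    define q where "q = measure M (E \<inter> A) / measure M A"
    \<comment> \<open>\<open>q\<close> is the conditional probability of \<open>E\<close> given the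
      event \<open>A\<close>. Half of its distance to 1/2 keeps the average over \<open>A\<close>
      strictly below \<open>1/2 - e\<close>.\<close>
    define e where "e = (1/2 - q) / 2"
    have e: "0 < e" "e < 1/2" "measure M (E \<inter> A) < (1/2 - e) * measure M A"
    proof -
      have q: "0 \<le> q" "q < 1/2"
        using less A0 by (simp_all add: q_def field_simps)
      then show "0 < e" by (simp add: e_def field_simps)
      show "e < 1/2"
        using q by (simp add: e_def field_simps)
      have "q < 1/2 - e"
        using q by (simp add: e_def field_simps)
      then show "measure M (E \<inter> A) < (1/2 - e) * measure M A"
        using A0 by (simp add: q_def pos_divide_less_eq)
    qed
    \<comment> \<open>On \<open>Y\<close> the conditional probability of \<open>E\<close> leaves
      room \<open>e\<close> for an added set. \<open>Y\<close> meets \<open>A\<close> in positive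
      measure, since otherwise the average over \<open>A\<close> would be too large.\<close>
    obtain Y where Y: "Y \<in> sets F"
        "\<And>A. A \<in> sets F \<Longrightarrow> A \<subseteq> Y \<Longrightarrow> measure M (E \<inter> A) \<le> (1/2 - e) * measure M (space M \<inter> A)"
        "\<And>A. A \<in> sets F \<Longrightarrow> A \<inter> Y = {} \<Longrightarrow> (1/2 - e) * measure M (space M \<inter> A) \<le> measure M (E \<inter> A)"
      using sub_Hahn_decomposition[OF sub sets.top \<open>E \<in> sets M\<close>, of "1/2 - e"] e(2) by auto
    have [measurable]: "A \<in> sets M" "Y \<in> sets M" using A Y(1) F by auto
    have spA: "space M \<inter> B = B" if "B \<in> sets F" for B
      using sets.sets_into_space[OF F[OF that]] by auto
    have AY: "A \<inter> Y \<in> sets F" "A - Y \<in> sets F" using A Y(1) by auto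
    have "0 < measure M (A \<inter> Y)"
    proof (rule ccontr)
      assume "\<not> ?thesis"
      then have 0: "measure M (A \<inter> Y) = 0"
        using measure_nonneg[of M "A \<inter> Y"] by linarith
      have "measure M A = measure M (A \<inter> Y) + measure M (A - Y)"
        by (subst finite_measure_Union[symmetric]) (auto intro!: arg_cong[where f="measure M"])
      then have "(1/2 - e) * measure M A = (1/2 - e) * measure M (A - Y)"
        using 0 by simp
      also have "\<dots> \<le> measure M (E \<inter> (A - Y))"
        using Y(3)[OF AY(2)] spA[OF AY(2)] by auto
      also have "\<dots> \<le> measure M (E \<inter> A)"
        by (intro finite_measure_mono) auto
      finally show False using e(3) by simp
    qed
    moreover have EAY: "measure M (E \<inter> (A \<inter> Y)) \<le> (1/2 - e) * measure M (A \<inter> Y)"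
      using Y(2)[OF AY(1)] spA[OF AY(1)] by auto
    moreover have "(1/2 - e) * measure M (A \<inter> Y) < 1 * measure M (A \<inter> Y)"
      using \<open>0 < measure M (A \<inter> Y)\<close> e(1) by (intro mult_strict_right_mono) auto
    moreover have "measure M (A \<inter> Y - E) = measure M (A \<inter> Y) - measure M (E \<inter> (A \<inter> Y))"
      by (subst finite_measure_Diff[symmetric]) (auto intro!: arg_cong[where f="measure M"])
    ultimately have "0 < measure M (A \<inter> Y - E)"
      by linarith
    moreover obtain n where n: "(1/2)^n < e"
      using real_arch_pow_inv[OF e(1), of "1/2"] by auto
    ultimately obtain P where P: "P \<in> sets M" "P \<subseteq> A \<inter> Y - E" "0 < measure M P"
        "\<And>B. B \<in> sets F \<Longrightarrow> measure M (P \<inter> B) \<le> (1/2)^n * measure M ((A \<inter> Y - E) \<inter> B)"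
      using small[of "A \<inter> Y - E" n] by auto
    note [measurable] = P(1)
    \<comment> \<open>Inside \<open>A \<inter> Y\<close> the bounds add up to
      \<open>(1/2 - e) + e\<close>; outside it \<open>P\<close> contributes nothing.\<close>
    have "measure M ((E \<union> P) \<inter> B) \<le> measure M B / 2" if B: "B \<in> sets F" for B
    proof -
      have [measurable]: "B \<in> sets M" by (rule F[OF B])
      have B': "B \<inter> (A \<inter> Y) \<in> sets F" "B - A \<inter> Y \<in> sets F" using B AY by auto
      have "measure M ((E \<union> P) \<inter> B) \<le> measure M (E \<inter> B) + measure M (P \<inter> B)"
        by (subst Int_Un_distrib2) (intro measure_Un_le, auto)
      moreover have "measure M (E \<inter> B) = measure M (E \<inter> (B \<inter> (A \<inter> Y))) + measure M (E \<inter> (B - A \<inter> Y))"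
        by (subst finite_measure_Union[symmetric]) (auto intro!: arg_cong[where f="measure M"])
      moreover have "measure M (E \<inter> (B \<inter> (A \<inter> Y))) \<le> (1/2 - e) * measure M (B \<inter> (A \<inter> Y))"
        using Y(2)[OF B'(1)] spA[OF B'(1)] by auto
      moreover have "measure M (E \<inter> (B - A \<inter> Y)) \<le> measure M (B - A \<inter> Y) / 2"
        by (rule E_le[OF B'(2)])
      moreover have "measure M (P \<inter> B) \<le> e * measure M (B \<inter> (A \<inter> Y))"
      proof -
        have "measure M (P \<inter> B) \<le> (1/2)^n * measure M ((A \<inter> Y - E) \<inter> B)" by (rule P(4)[OF B])
        moreover have "\<dots> \<le> e * measure M (B \<inter> (A \<inter> Y))"
          using n e(1) by (intro mult_mono finite_measure_mono) auto
        finally show ?thesis .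
      qed
      moreover have "measure M B = measure M (B \<inter> (A \<inter> Y)) + measure M (B - A \<inter> Y)"
        by (subst finite_measure_Union[symmetric]) (auto intro!: arg_cong[where f="measure M"])
      ultimately show ?thesis by (simp add: algebra_simps)
    qed
    then have "E \<union> P \<in> \<G>" by (auto simp: \<G>_def)
    then have "measure M (E \<union> P) \<le> measure M E" by (rule E(2)) auto
    moreover have "measure M (E \<union> P) = measure M E + measure M P"
      using P(2) by (intro finite_measure_Union) auto
    ultimately show False using P(3) by simp
  qed
  then show ?thesis using \<open>E \<in> sets M\<close> by blast
qed

section \<open>Independent families\<close>

text \<open>Maharam's lemma asks for splitting on every set of positive measure, so
  \<open>not_small_generated\<close> has to be applied to conditional measures.\<close>

lemma (in real_valued_measure) real_valued_measure_uniform: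
  assumes P: "P \<subseteq> Field \<kappa>" "0 < measure M P"
  shows "real_valued_measure (uniform_measure M P) \<kappa>"
proof -
  have em: "emeasure M P \<noteq> 0" "emeasure M P \<noteq> \<infinity>"
    using P(2) by (auto simp: emeasure_eq_measure)
  have null: "N \<in> null_sets (uniform_measure M P) \<longleftrightarrow> N \<subseteq> Field \<kappa> \<and> P \<inter> N \<in> null_sets M" for N
  proof (cases "N \<subseteq> Field \<kappa>")
    case True
    then have "emeasure (uniform_measure M P) N = emeasure M (P \<inter> N) / emeasure M P"
      using P(1) by (intro emeasure_uniform_measure) auto
    then show ?thesis
      using True em P(1) by (auto simp: null_sets_def ennreal_divide_eq_0_iff)
  next
    case False
    then show ?thesis by (auto simp: null_sets_def)
  qed
  have meas: "measure (uniform_measure M P) Y = measure M (P \<inter> Y) / measure M P" if "Y \<subseteq> Field \<kappa>" for Y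
    using P(1) that em by (intro measure_uniform_measure) auto
  interpret U: prob_space "uniform_measure M P"
    by (rule prob_space_uniform_measure[OF em])
  show ?thesis
  proof
    show "Card_order \<kappa>" by (rule Card)
    show "sets (uniform_measure M P) = Pow (Field \<kappa>)" by (simp add: sets_M)
    show "\<Union>\<A> \<in> null_sets (uniform_measure M P)"
      if "|\<A>| <o \<kappa>" "\<A> \<subseteq> null_sets (uniform_measure M P)" for \<A>
    proof -
      have "(\<Union>A\<in>\<A>. P \<inter> A) \<in> null_sets M"
        using that null by (intro null_UN) auto
      then have "P \<inter> \<Union>\<A> \<in> null_sets M" by (simp only: Int_Union)
      moreover have "\<Union>\<A> \<subseteq> Field \<kappa>" using that(2) null by blast
      ultimately show ?thesis using null by simp
    qed
    show "{x} \<in> null_sets (uniform_measure M P)" if "x \<in> Field \<kappa>" for x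
      using that null null_subset[OF null_singleton[OF that], of "P \<inter> {x}"] by auto
    show "atomless (uniform_measure M P)"
      unfolding atomless_def
    proof (intro ballI impI)
      fix Y assume Y: "Y \<in> sets (uniform_measure M P)" "0 < measure (uniform_measure M P) Y"
      then have YF: "Y \<subseteq> Field \<kappa>" by simp
      then have "0 < measure M (P \<inter> Y)"
        using Y(2) P(2) by (simp add: meas zero_less_divide_iff)
      then obtain Z where Z: "Z \<subseteq> P \<inter> Y" "0 < measure M Z" "measure M Z < measure M (P \<inter> Y)"
        using atomless P(1) YF unfolding atomless_def by (metis Int_lower1 in_sets subset_trans)
      then have "P \<inter> Z = Z" "Z \<subseteq> Field \<kappa>" using P(1) by auto
      then show "\<exists>Z\<in>sets (uniform_measure M P). Z \<subseteq> Y \<and> 0 < measure (uniform_measure M P) Z \<and>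
          measure (uniform_measure M P) Z < measure (uniform_measure M P) Y"
        using Z P(2) YF by (intro bexI[of _ Z]) (auto simp: meas divide_strict_right_mono)
    qed
  qed
qed

text \<open>The factor \<open>space M\<close> gives the empty intersection its value 1. Only the
  events themselves are intersected; complements are recovered in
  \<open>indep_halves_compl\<close>.\<close>

definition (in prob_space) indep_halves :: "('i \<Rightarrow> 'a set) \<Rightarrow> 'i set \<Rightarrow> bool" where
  "indep_halves E I \<longleftrightarrow> (\<forall>i\<in>I. E i \<in> sets M) \<and>
    (\<forall>F\<subseteq>I. finite F \<longrightarrow> measure M (space M \<inter> (\<Inter>i\<in>F. E i)) = (1/2) ^ card F)"

lemma (in prob_space) indep_halvesD:
  assumes "indep_halves E I"
  shows "i \<in> I \<Longrightarrow> E i \<in> sets M"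
    and "F \<subseteq> I \<Longrightarrow> finite F \<Longrightarrow> measure M (space M \<inter> (\<Inter>i\<in>F. E i)) = (1/2) ^ card F"
  using assms by (auto simp: indep_halves_def)

text \<open>Independence has finite character, so Zorn's lemma gives a maximal family. If it were
  small, \<open>not_small_generated\<close> would supply the splitting hypothesis of Maharam's
  lemma, and the event obtained there would extend the family.\<close>

lemma (in real_valued_measure) large_indep_halves:
  obtains \<E> where "indep_halves id \<E>" "\<not> |\<E>| <o \<kappa>"
proof -
  have "\<exists>\<E>\<in>{\<E>. indep_halves id \<E>}. \<forall>\<E>'\<in>{\<E>. indep_halves id \<E>}. \<E> \<subseteq> \<E>' \<longrightarrow> \<E>' = \<E>"
  proof (rule subset_Zorn')
    fix C assume C: "subset.chain {\<E>. indep_halves id \<E>} C"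
    have "measure M (space M \<inter> (\<Inter>i\<in>F. i)) = (1/2) ^ card F" if F: "finite F" "F \<subseteq> \<Union>C" for F
    proof (cases "F = {}")
      case True
      then show ?thesis by (simp add: prob_space)
    next
      case False
      then have "C \<noteq> {}" using F by auto
      then obtain \<E> where "\<E> \<in> C" "F \<subseteq> \<E>"
        using finite_subset_Union_chain[OF F _ C] by blast
      then show ?thesis
        using C F(1) by (auto simp: subset_chain_def indep_halves_def)
    qed
    moreover have "\<forall>E\<in>\<Union>C. E \<in> sets M"
      using C unfolding subset_chain_def indep_halves_def by fastforce
    ultimately show "\<Union>C \<in> {\<E>. indep_halves id \<E>}"
      by (simp add: indep_halves_def)
  qed
  then obtain \<E> where \<E>: "indep_halves id \<E>" "\<And>\<E>'. indep_halves id \<E>' \<Longrightarrow> \<E> \<subseteq> \<E>' \<Longrightarrow> \<E>' = \<E>"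
    by blast
  have "\<not> |\<E>| <o \<kappa>"
  proof
    assume less: "|\<E>| <o \<kappa>"
    have Pow: "\<E> \<subseteq> Pow (Field \<kappa>)"
      using \<E>(1) by (auto simp: indep_halves_def)
    let ?F = "sigma (Field \<kappa>) \<E>"
    have sets_F: "sets ?F = sigma_sets (Field \<kappa>) \<E>"
      using Pow by simp
    have sub: "subalgebra M ?F"
      using sigma_sets_into_sp[OF Pow] Pow by (auto simp: subalgebra_def space_M)
    have "\<exists>E\<in>sets M. \<forall>A\<in>sets ?F. measure M (E \<inter> A) = measure M A / 2"
    proof (rule relatively_independent_half[OF sub])
      fix P assume P: "P \<in> sets M" "0 < measure M P"
      show "\<exists>Q\<in>sets M. Q \<subseteq> P \<and> (\<forall>D\<in>sets ?F. 0 < measure M (sym_diff Q (D \<inter> P)))"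
      proof (rule ccontr)
        assume neg: "\<not> ?thesis"
        have PF: "P \<subseteq> Field \<kappa>" using P(1) by simp
        interpret U: real_valued_measure "uniform_measure M P" \<kappa>
          by (rule real_valued_measure_uniform[OF PF P(2)])
        have "\<exists>D\<in>sigma_sets (Field \<kappa>) \<E>. sym_diff Q D \<in> null_sets (uniform_measure M P)"
          if Q: "Q \<subseteq> Field \<kappa>" for Q
        proof -
          have "Q \<inter> P \<in> sets M" "Q \<inter> P \<subseteq> P" using PF by auto
          then obtain D where D: "D \<in> sets ?F" "\<not> 0 < measure M (sym_diff (Q \<inter> P) (D \<inter> P))"
            using neg by blast
          have DF: "D \<subseteq> Field \<kappa>"
            using D(1) sub sets.sets_into_space[of D ?F] Pow by simp
          have "P \<inter> sym_diff Q D = sym_diff (Q \<inter> P) (D \<inter> P)" by blast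
          then have "measure M (P \<inter> sym_diff Q D) = 0"
            using D(2) by (simp add: zero_less_measure_iff)
          then have "emeasure (uniform_measure M P) (sym_diff Q D) = 0"
            using PF Q DF by (subst emeasure_uniform_measure) (auto simp: emeasure_eq_measure)
          then show ?thesis
            using D(1) Q DF unfolding sets_F by (intro bexI[of _ D] null_setsI) auto
        qed
        then show False by (rule U.not_small_generated[OF Pow less])
      qed
    qed
    then obtain E where E: "E \<in> sets M" "\<And>A. A \<in> sigma_sets (Field \<kappa>) \<E> \<Longrightarrow> measure M (E \<inter> A) = measure M A / 2"
      unfolding sets_F by blast
    interpret sg: sigma_algebra "Field \<kappa>" "sigma_sets (Field \<kappa>) \<E>"
      by (rule sigma_algebra_sigma_sets[OF Pow])
    \<comment> \<open>As a member, \<open>E\<close> would be independent of itself and so have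
      measure 0 instead of 1/2.\<close>
    have "E \<notin> \<E>"
    proof
      assume "E \<in> \<E>"
      then have "measure M (E \<inter> E) = measure M E / 2"
        by (intro E(2) sigma_sets.Basic)
      then have "measure M E = 0"
        unfolding Int_absorb by linarith
      moreover have "measure M (space M \<inter> (\<Inter>i\<in>{E}. i)) = 1/2"
        using indep_halvesD(2)[OF \<E>(1), of "{E}"] \<open>E \<in> \<E>\<close> by simp
      moreover have "space M \<inter> E = E" using E(1) by (auto simp: space_M)
      ultimately show False by simp
    qed
    have "measure M (space M \<inter> (\<Inter>i\<in>F. i)) = (1/2) ^ card F" if F: "F \<subseteq> insert E \<E>" "finite F" for F
    proof (cases "E \<in> F")
      case False
      then show ?thesis using F \<E>(1) by (auto simp: indep_halves_def)
    next
      case True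
      let ?A = "space M \<inter> (\<Inter>i\<in>F - {E}. i)"
      have "F - {E} \<subseteq> sigma_sets (Field \<kappa>) \<E>" using F(1) by auto
      then have A: "?A \<in> sigma_sets (Field \<kappa>) \<E>"
      proof (cases "F - {E} = {}")
        case True
        then show ?thesis unfolding True by (simp add: space_M sigma_sets_top)
      next
        case False
        then have "(\<Inter>i\<in>F - {E}. i) \<in> sigma_sets (Field \<kappa>) \<E>"
          using F(2) \<open>F - {E} \<subseteq> sigma_sets (Field \<kappa>) \<E>\<close> by (intro sg.finite_INT) auto
        then show ?thesis
          unfolding space_M by (intro sg.Int sg.top)
      qed
      have "space M \<inter> (\<Inter>i\<in>F. i) = E \<inter> ?A" using True by auto
      then have "measure M (space M \<inter> (\<Inter>i\<in>F. i)) = measure M ?A / 2"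
        using E(2)[OF A] by simp
      also have "measure M ?A = (1/2) ^ card (F - {E})"
        using indep_halvesD(2)[OF \<E>(1), of "F - {E}"] F by auto
      also have "\<dots> / 2 = (1/2) ^ card F"
        using card_Suc_Diff1[OF F(2) True] by (metis power_Suc mult.commute times_divide_eq_right mult.right_neutral)
      finally show ?thesis .
    qed
    then have "indep_halves id (insert E \<E>)"
      using E(1) \<E>(1) by (simp add: indep_halves_def)
    then show False using \<E>(2)[of "insert E \<E>"] \<open>E \<notin> \<E>\<close> by blast
  qed
  with \<E>(1) that show thesis by blast
qed

section \<open>Complementary events and Bessel's inequality\<close>

context prob_space begin

text \<open>Events are complemented one at a time, each step being the difference of
  \<open>(1/2)^m\<close> and \<open>(1/2)^Suc m\<close>. This makes the two colours interchangeable
  later.\<close>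

lemma indep_halves_compl:
  assumes "indep_halves E I"
  shows "indep_halves (\<lambda>i. space M - E i) I"
proof -
  have E [measurable]: "E i \<in> sets M" if "i \<in> I" for i
    using assms that by (auto simp: indep_halves_def)
  have "measure M (space M \<inter> (\<Inter>i\<in>F. E i) \<inter> (\<Inter>i\<in>G. space M - E i)) = (1/2)^(card F + card G)"
    if "finite G" "finite F" "F \<subseteq> I" "G \<subseteq> I" "F \<inter> G = {}" for F G
    using that
  proof (induction G arbitrary: F)
    case empty
    then show ?case using assms by (simp add: indep_halves_def)
  next
    case (insert g G)
    let ?A = "\<lambda>F. space M \<inter> (\<Inter>i\<in>F. E i) \<inter> (\<Inter>i\<in>G. space M - E i)"
    have Am: "?A F \<in> sets M" if "finite F" "F \<subseteq> I" for F
    proof -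
      have "space M \<inter> (\<Inter>i\<in>F. E i) \<in> sets M"
        using that E by (cases "F = {}") (auto intro!: sets.Int sets.finite_INT)
      moreover have "space M \<inter> (\<Inter>i\<in>G. space M - E i) \<in> sets M"
      proof (cases "G = {}")
        case False
        have "(\<Inter>i\<in>G. space M - E i) \<in> sets M"
          using insert.hyps(1) insert.prems False by (intro sets.finite_INT) auto
        then show ?thesis by simp
      qed simp
      moreover have "?A F = (space M \<inter> (\<Inter>i\<in>F. E i)) \<inter> (space M \<inter> (\<Inter>i\<in>G. space M - E i))"
        by blast
      ultimately show ?thesis by simp
    qed
    have "space M \<inter> (\<Inter>i\<in>F. E i) \<inter> (\<Inter>i\<in>insert g G. space M - E i) = ?A F - ?A (insert g F)"
      by auto
    moreover have "measure M (?A F - ?A (insert g F)) = measure M (?A F) - measure M (?A (insert g F))"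
      using insert.prems by (intro finite_measure_Diff Am) auto
    moreover have "measure M (?A F) = (1/2)^(card F + card G)"
      using insert.prems by (intro insert.IH) auto
    moreover have "measure M (?A (insert g F)) = (1/2)^(card (insert g F) + card G)"
      using insert.prems insert.hyps by (intro insert.IH) auto
    moreover have "card (insert g F) = Suc (card F)" "card (insert g G) = Suc (card G)"
      using insert.prems insert.hyps by auto
    ultimately show ?case by simp
  qed
  from this[of _ "{}"] show ?thesis
    using E by (auto simp: indep_halves_def)
qed

text \<open>Bessel's inequality for the orthogonal functions \<open>indicator (Z \<alpha>) - p\<close>.\<close>

lemma countable_correlated:
  assumes Z: "\<And>\<alpha>. \<alpha> \<in> \<Theta> \<Longrightarrow> Z \<alpha> \<in> sets M" and Y: "Y \<in> sets M"
    and p: "\<And>\<alpha>. \<alpha> \<in> \<Theta> \<Longrightarrow> measure M (Z \<alpha>) = p"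
    and pp: "\<And>\<alpha> \<beta>. \<alpha> \<in> \<Theta> \<Longrightarrow> \<beta> \<in> \<Theta> \<Longrightarrow> \<alpha> \<noteq> \<beta> \<Longrightarrow> measure M (Z \<alpha> \<inter> Z \<beta>) = p\<^sup>2"
  shows "countable {\<alpha> \<in> \<Theta>. p * measure M Y < measure M (Y \<inter> Z \<alpha>)}"
proof -
  define f where "f \<alpha> x = indicator (Z \<alpha>) x - p" for \<alpha> and x :: 'a
  define y where "y = (indicator Y :: 'a \<Rightarrow> real)"
  have ff: "integrable M (\<lambda>x. f \<alpha> x * f \<beta> x)"
    "(\<integral>x. f \<alpha> x * f \<beta> x \<partial>M) = (if \<alpha> = \<beta> then p - p\<^sup>2 else 0)" if "\<alpha> \<in> \<Theta>" "\<beta> \<in> \<Theta>" for \<alpha> \<beta>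
  proof -
    have eq: "f \<alpha> x * f \<beta> x = indicator (Z \<alpha> \<inter> Z \<beta>) x - p * indicator (Z \<alpha>) x - p * indicator (Z \<beta>) x + p\<^sup>2" for x
      by (simp add: f_def indicator_inter_arith algebra_simps power2_eq_square)
    show "integrable M (\<lambda>x. f \<alpha> x * f \<beta> x)"
      unfolding eq using Z[OF that(1)] Z[OF that(2)] by (intro Bochner_Integration.integrable_add Bochner_Integration.integrable_diff integrable_mult_right) (auto simp: emeasure_eq_measure)
    have "(\<integral>x. f \<alpha> x * f \<beta> x \<partial>M) = measure M (Z \<alpha> \<inter> Z \<beta>) - p * measure M (Z \<alpha>) - p * measure M (Z \<beta>) + p\<^sup>2"
      unfolding eq using Z[OF that(1)] Z[OF that(2)] sets.sets_into_space[OF Z[OF that(1)]] sets.sets_into_space[OF Z[OF that(2)]]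
      by (simp add: emeasure_eq_measure prob_space Int_absorb2 le_infI1)
    then show "(\<integral>x. f \<alpha> x * f \<beta> x \<partial>M) = (if \<alpha> = \<beta> then p - p\<^sup>2 else 0)"
      using p[OF that(1)] p[OF that(2)] pp[OF that] by (simp add: power2_eq_square)
  qed
  have fy: "integrable M (\<lambda>x. f \<alpha> x * y x)" "(\<integral>x. f \<alpha> x * y x \<partial>M) = measure M (Y \<inter> Z \<alpha>) - p * measure M Y"
    if "\<alpha> \<in> \<Theta>" for \<alpha>
  proof -
    have eq: "f \<alpha> x * y x = indicator (Y \<inter> Z \<alpha>) x - p * indicator Y x" for x
      by (simp add: f_def y_def indicator_inter_arith algebra_simps)
    show "integrable M (\<lambda>x. f \<alpha> x * y x)"
      unfolding eq using Z[OF that] Y by (intro Bochner_Integration.integrable_diff integrable_mult_right) (auto simp: emeasure_eq_measure)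
    show "(\<integral>x. f \<alpha> x * y x \<partial>M) = measure M (Y \<inter> Z \<alpha>) - p * measure M Y"
      unfolding eq using Z[OF that] Y sets.sets_into_space[OF Y]
      by (simp add: emeasure_eq_measure Int_absorb2 le_infI1)
  qed
  have yy: "integrable M (\<lambda>x. y x * y x)" "(\<integral>x. y x * y x \<partial>M) = measure M Y"
    using Y sets.sets_into_space[OF Y]
    by (simp_all add: y_def indicator_inter_arith[symmetric] emeasure_eq_measure Int_absorb2)
  have fin: "finite {\<alpha> \<in> \<Theta>. \<delta> < measure M (Y \<inter> Z \<alpha>) - p * measure M Y}" (is "finite ?S") if \<delta>: "0 < \<delta>" for \<delta>
  proof -
    obtain k :: nat where k: "1 / \<delta>\<^sup>2 < k" using reals_Archimedean2 by blast
    have "card F \<le> k" if F: "F \<subseteq> ?S" "finite F" for F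
    proof -
      \<comment> \<open>Expand the squared norm of the sum of the \<open>f \<alpha>\<close> minus
        \<open>s * y\<close>. The inner products with \<open>y\<close> sum to at least
        \<open>s\<close>, which leaves \<open>s\<^sup>2 \<le> n\<close>, that is,
        \<open>n * \<delta>\<^sup>2 \<le> 1\<close> unless \<open>n = 0\<close>.\<close>
      define n s where "n = real (card F)" and "s = real (card F) * \<delta>"
      have FT: "F \<subseteq> \<Theta>" using F by auto
      have "0 \<le> (\<integral>x. ((\<Sum>\<alpha>\<in>F. f \<alpha> x) - s * y x)\<^sup>2 \<partial>M)"
        by simp
      also have "(\<lambda>x. ((\<Sum>\<alpha>\<in>F. f \<alpha> x) - s * y x)\<^sup>2) =
          (\<lambda>x. (\<Sum>\<alpha>\<in>F. \<Sum>\<beta>\<in>F. f \<alpha> x * f \<beta> x) - 2 * s * (\<Sum>\<alpha>\<in>F. f \<alpha> x * y x) + s\<^sup>2 * (y x * y x))"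
      proof
        fix x
        have "((\<Sum>\<alpha>\<in>F. f \<alpha> x) - s * y x)\<^sup>2 = (\<Sum>\<alpha>\<in>F. f \<alpha> x) * (\<Sum>\<alpha>\<in>F. f \<alpha> x)
            - 2 * s * ((\<Sum>\<alpha>\<in>F. f \<alpha> x) * y x) + s\<^sup>2 * (y x * y x)"
          by (simp add: power2_eq_square algebra_simps)
        also have "(\<Sum>\<alpha>\<in>F. f \<alpha> x) * (\<Sum>\<alpha>\<in>F. f \<alpha> x) = (\<Sum>\<alpha>\<in>F. \<Sum>\<beta>\<in>F. f \<alpha> x * f \<beta> x)"
          by (rule sum_product)
        also have "(\<Sum>\<alpha>\<in>F. f \<alpha> x) * y x = (\<Sum>\<alpha>\<in>F. f \<alpha> x * y x)"
          by (rule sum_distrib_right)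
        finally show "((\<Sum>\<alpha>\<in>F. f \<alpha> x) - s * y x)\<^sup>2 =
            (\<Sum>\<alpha>\<in>F. \<Sum>\<beta>\<in>F. f \<alpha> x * f \<beta> x) - 2 * s * (\<Sum>\<alpha>\<in>F. f \<alpha> x * y x) + s\<^sup>2 * (y x * y x)"
          .
      qed
      also have "(\<integral>x. (\<Sum>\<alpha>\<in>F. \<Sum>\<beta>\<in>F. f \<alpha> x * f \<beta> x) - 2 * s * (\<Sum>\<alpha>\<in>F. f \<alpha> x * y x) + s\<^sup>2 * (y x * y x) \<partial>M) =
          (\<Sum>\<alpha>\<in>F. \<Sum>\<beta>\<in>F. (\<integral>x. f \<alpha> x * f \<beta> x \<partial>M)) - 2 * s * (\<Sum>\<alpha>\<in>F. (\<integral>x. f \<alpha> x * y x \<partial>M)) + s\<^sup>2 * measure M Y"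
      proof -
        have i: "integrable M (\<lambda>x. \<Sum>\<beta>\<in>F. f \<alpha> x * f \<beta> x)" if "\<alpha> \<in> F" for \<alpha>
          using FT that by (intro Bochner_Integration.integrable_sum ff) auto
        have i2: "integrable M (\<lambda>x. \<Sum>\<alpha>\<in>F. \<Sum>\<beta>\<in>F. f \<alpha> x * f \<beta> x)"
          by (intro Bochner_Integration.integrable_sum i)
        have i3: "integrable M (\<lambda>x. \<Sum>\<alpha>\<in>F. f \<alpha> x * y x)"
          using FT by (intro Bochner_Integration.integrable_sum fy) auto
        have "(\<integral>x. (\<Sum>\<alpha>\<in>F. \<Sum>\<beta>\<in>F. f \<alpha> x * f \<beta> x) \<partial>M) = (\<Sum>\<alpha>\<in>F. \<Sum>\<beta>\<in>F. (\<integral>x. f \<alpha> x * f \<beta> x \<partial>M))"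
          using FT by (subst Bochner_Integration.integral_sum[OF i])
            (auto intro!: sum.cong Bochner_Integration.integral_sum ff(1))
        moreover have "(\<integral>x. (\<Sum>\<alpha>\<in>F. f \<alpha> x * y x) \<partial>M) = (\<Sum>\<alpha>\<in>F. (\<integral>x. f \<alpha> x * y x \<partial>M))"
          using FT fy by (intro Bochner_Integration.integral_sum) auto
        ultimately show ?thesis
          using i2 i3 yy by simp
      qed
      also have "(\<Sum>\<alpha>\<in>F. \<Sum>\<beta>\<in>F. (\<integral>x. f \<alpha> x * f \<beta> x \<partial>M)) = (\<Sum>\<alpha>\<in>F. \<Sum>\<beta>\<in>F. if \<alpha> = \<beta> then p - p\<^sup>2 else 0)"
        using FT by (intro sum.cong ff(2)) auto
      also have "\<dots> = n * (p - p\<^sup>2)"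
        using F(2) by (simp add: n_def)
      finally have 1: "2 * s * (\<Sum>\<alpha>\<in>F. (\<integral>x. f \<alpha> x * y x \<partial>M)) \<le> n * (p - p\<^sup>2) + s\<^sup>2 * measure M Y"
        by simp
      have "(\<Sum>\<alpha>\<in>F. \<delta>) \<le> (\<Sum>\<alpha>\<in>F. (\<integral>x. f \<alpha> x * y x \<partial>M))"
        using F(1) fy(2) by (intro sum_mono) (auto intro: less_imp_le)
      then have "s \<le> (\<Sum>\<alpha>\<in>F. (\<integral>x. f \<alpha> x * y x \<partial>M))" by (simp add: s_def)
      then have "s * s \<le> s * (\<Sum>\<alpha>\<in>F. (\<integral>x. f \<alpha> x * y x \<partial>M))"
        using \<delta> by (intro mult_left_mono) (auto simp: s_def)
      moreover have "s\<^sup>2 * measure M Y \<le> s\<^sup>2 * 1"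
        by (intro mult_left_mono) auto
      moreover have "n * (p - p\<^sup>2) \<le> n * 1"
      proof (rule mult_left_mono)
        have "0 \<le> (p - 1/2)\<^sup>2" by simp
        then show "p - p\<^sup>2 \<le> 1" by (simp add: power2_eq_square algebra_simps)
      qed (simp add: n_def)
      ultimately have "s\<^sup>2 \<le> n"
        using 1 by (simp add: power2_eq_square)
      then have "n * (n * \<delta>\<^sup>2) \<le> n * 1"
        by (simp add: s_def n_def power_mult_distrib power2_eq_square algebra_simps)
      moreover have "0 \<le> n" by (simp add: n_def)
      ultimately have "n = 0 \<or> n * \<delta>\<^sup>2 \<le> 1"
        using mult_le_cancel_left_pos[of n "n * \<delta>\<^sup>2" 1] by linarith
      then have "n \<le> 1 / \<delta>\<^sup>2"
        using \<delta> by (auto simp: pos_le_divide_eq)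
      with k have "n < k" by linarith
      then show ?thesis by (simp add: n_def)
    qed
    then show "finite ?S"
      using finite_if_finite_subsets_card_bdd[of ?S k] by blast
  qed
  have "{\<alpha> \<in> \<Theta>. p * measure M Y < measure M (Y \<inter> Z \<alpha>)} =
      (\<Union>n. {\<alpha> \<in> \<Theta>. 1 / Suc n < measure M (Y \<inter> Z \<alpha>) - p * measure M Y})" (is "?L = ?R")
  proof
    show "?L \<subseteq> ?R"
    proof
      fix \<alpha> assume "\<alpha> \<in> ?L"
      then have \<alpha>: "\<alpha> \<in> \<Theta>" "0 < measure M (Y \<inter> Z \<alpha>) - p * measure M Y" by auto
      from nat_approx_posE[OF \<alpha>(2)] obtain n where "1 / Suc n < measure M (Y \<inter> Z \<alpha>) - p * measure M Y" .
      with \<alpha>(1) show "\<alpha> \<in> ?R" by blast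
    qed
    show "?R \<subseteq> ?L"
    proof
      fix \<alpha> assume "\<alpha> \<in> ?R"
      then obtain n where n: "\<alpha> \<in> \<Theta>" "1 / Suc n < measure M (Y \<inter> Z \<alpha>) - p * measure M Y" by blast
      have "0 < 1 / real (Suc n)" by simp
      then have "0 < measure M (Y \<inter> Z \<alpha>) - p * measure M Y"
        using n(2) by (rule order.strict_trans)
      with n(1) show "\<alpha> \<in> ?L" by simp
    qed
  qed
  also have "countable \<dots>"
    by (intro countable_UN countable_finite[OF fin]) auto
  finally show ?thesis .
qed

end

section \<open>The colouring\<close>

text \<open>For all but countably many \<open>\<alpha>\<close>, the event that
  \<open>\<alpha>\<close> lies in \<open>A x\<close> has measure at most \<open>(1/2) ^ N\<close>
  for every \<open>N\<close>. As \<open>A x\<close> is uncountable, fewer than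
  \<open>\<kappa>\<close> such null events cover \<open>P\<close>.\<close>

lemma (in real_valued_measure) indep_halves_monochromatic_null:
  fixes E :: "'a \<times> nat \<Rightarrow> 'k set"
  assumes E: "indep_halves E (\<Theta> \<times> UNIV)" and \<Theta>: "|\<Theta>| <o \<kappa>"
    and P: "P \<subseteq> Field \<kappa>"
    and A: "\<And>x. x \<in> P \<Longrightarrow> A x \<subseteq> \<Theta>" "\<And>x. x \<in> P \<Longrightarrow> uncountable (A x)"
    and B: "\<And>x. x \<in> P \<Longrightarrow> infinite (B x)"
    and AB: "\<And>x \<alpha> n. x \<in> P \<Longrightarrow> \<alpha> \<in> A x \<Longrightarrow> n \<in> B x \<Longrightarrow> x \<in> E (\<alpha>, n)"
  shows "P \<in> null_sets M"
proof -
  \<comment> \<open>Coding an \<open>N\<close>-element subset of \<open>B x\<close> by a natural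
    number splits \<open>P\<close> into countably many pieces for each \<open>N\<close>.\<close>
  have "\<exists>k. set_decode k \<subseteq> B x \<and> card (set_decode k) = N" if x: "x \<in> P" for x N
  proof -
    obtain S where "S \<subseteq> B x" "finite S" "card S = N"
      using infinite_arbitrarily_large[OF B[OF x]] by blast
    then show ?thesis
      by (intro exI[of _ "set_encode S"]) simp
  qed
  then obtain f where f: "\<And>x N. x \<in> P \<Longrightarrow> set_decode (f x N) \<subseteq> B x"
      "\<And>x N. x \<in> P \<Longrightarrow> card (set_decode (f x N)) = N"
    by metis
  define Y where "Y N k = {x \<in> P. f x N = k}" for N k
  define Z where "Z k \<alpha> = Field \<kappa> \<inter> (\<Inter>n\<in>set_decode k. E (\<alpha>, n))" for k \<alpha>
  have ZF: "Z k \<alpha> \<subseteq> Field \<kappa>" for k \<alpha>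
    by (auto simp: Z_def)
  have YF: "Y N k \<subseteq> Field \<kappa>" for N k
    using P by (auto simp: Y_def)
  have mZ: "measure M (Z k \<alpha>) = (1/2) ^ card (set_decode k)" if "\<alpha> \<in> \<Theta>" for k \<alpha>
  proof -
    have "Z k \<alpha> = space M \<inter> (\<Inter>i\<in>Pair \<alpha> ` set_decode k. E i)"
      by (simp add: Z_def space_M)
    also have "measure M \<dots> = (1/2) ^ card (Pair \<alpha> ` set_decode k)"
      using that by (intro indep_halvesD(2)[OF E]) auto
    also have "card (Pair \<alpha> ` set_decode k) = card (set_decode k)"
      by (intro card_image) (auto simp: inj_on_def)
    finally show ?thesis .
  qed
  have mZZ: "measure M (Z k \<alpha> \<inter> Z k \<beta>) = ((1/2) ^ card (set_decode k))\<^sup>2"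
    if "\<alpha> \<in> \<Theta>" "\<beta> \<in> \<Theta>" "\<alpha> \<noteq> \<beta>" for k \<alpha> \<beta>
  proof -
    have "Z k \<alpha> \<inter> Z k \<beta> = space M \<inter> (\<Inter>i\<in>{\<alpha>, \<beta>} \<times> set_decode k. E i)"
      by (auto simp: Z_def space_M)
    also have "measure M \<dots> = (1/2) ^ card ({\<alpha>, \<beta>} \<times> set_decode k)"
      using that by (intro indep_halvesD(2)[OF E]) auto
    also have "card ({\<alpha>, \<beta>} \<times> set_decode k) = card (set_decode k) * 2"
      using that by (simp add: card_cartesian_product)
    finally show ?thesis by (simp add: power_mult)
  qed
  \<comment> \<open>\<open>C\<close> collects the indices positively correlated with some piece;
    Bessel's inequality applies to each of the countably many pairs of \<open>N\<close> and
    \<open>k\<close>.\<close>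
  define C where "C = (\<Union>N k. {\<alpha> \<in> \<Theta>. (1/2) ^ card (set_decode k) * measure M (Y N k) < measure M (Y N k \<inter> Z k \<alpha>)})"
  have C: "countable C"
    unfolding C_def using mZ mZZ ZF YF by (intro countable_UN countable_correlated) auto
  have null: "{x \<in> P. \<alpha> \<in> A x} \<in> null_sets M" if \<alpha>: "\<alpha> \<in> \<Theta>" "\<alpha> \<notin> C" for \<alpha>
  proof -
    let ?S = "{x \<in> P. \<alpha> \<in> A x}"
    have SF: "?S \<subseteq> Field \<kappa>" using P by auto
    have le: "measure M ?S \<le> (1/2) ^ N" for N
    proof -
      have disj: "disjoint_family (Y N)"
        by (auto simp: disjoint_family_on_def Y_def)
      have s1: "(\<lambda>k. measure M (?S \<inter> Y N k)) sums measure M (\<Union>k. ?S \<inter> Y N k)"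
        using disj SF by (intro finite_measure_UNION) (auto simp: disjoint_family_on_def)
      have s2: "(\<lambda>k. (1/2) ^ N * measure M (Y N k)) sums ((1/2) ^ N * measure M (\<Union>k. Y N k))"
        using disj YF by (intro sums_mult finite_measure_UNION) auto
      have "measure M (?S \<inter> Y N k) \<le> (1/2) ^ N * measure M (Y N k)" for k
      proof (cases "?S \<inter> Y N k = {}")
        case True
        then show ?thesis by (simp only: True) simp
      next
        case False
        then have N: "card (set_decode k) = N"
          using f(2) by (auto simp: Y_def)
        have "?S \<inter> Y N k \<subseteq> Y N k \<inter> Z k \<alpha>"
        proof
          fix x assume "x \<in> ?S \<inter> Y N k"
          then have x: "x \<in> P" "\<alpha> \<in> A x" "f x N = k" "x \<in> Y N k"
            by (auto simp: Y_def)
          then have "\<forall>n\<in>set_decode k. x \<in> E (\<alpha>, n)"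
            using f(1)[OF x(1), of N] AB[OF x(1,2)] by auto
          then show "x \<in> Y N k \<inter> Z k \<alpha>"
            using x(1,4) P by (auto simp: Z_def)
        qed
        then have "measure M (?S \<inter> Y N k) \<le> measure M (Y N k \<inter> Z k \<alpha>)"
          using YF[of N k] by (intro finite_measure_mono) auto
        also have "\<dots> \<le> (1/2) ^ card (set_decode k) * measure M (Y N k)"
          using \<alpha> unfolding C_def by (auto simp: not_less)
        finally show ?thesis unfolding N .
      qed
      then have "measure M (\<Union>k. ?S \<inter> Y N k) \<le> (1/2) ^ N * measure M (\<Union>k. Y N k)"
        by (rule sums_le[OF _ s1 s2])
      also have "\<dots> \<le> (1/2) ^ N * 1"
        by (intro mult_left_mono) auto
      also have "(\<Union>k. ?S \<inter> Y N k) = ?S"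
        by (auto simp: Y_def)
      finally show ?thesis by simp
    qed
    have "measure M ?S \<le> 0"
      by (rule LIMSEQ_le_const[OF LIMSEQ_realpow_zero[of "1/2"]]) (use le in auto)
    then have "measure M ?S = 0"
      using measure_nonneg[of M ?S] by linarith
    then show ?thesis
      using SF by (intro null_setsI) (auto simp: emeasure_eq_measure)
  qed
  have "(\<Union>\<alpha>\<in>\<Theta> - C. {x \<in> P. \<alpha> \<in> A x}) \<in> null_sets M"
    using null by (intro null_UN card_mono_less[OF \<Theta>]) auto
  moreover have "P \<subseteq> (\<Union>\<alpha>\<in>\<Theta> - C. {x \<in> P. \<alpha> \<in> A x})"
  proof
    fix x assume x: "x \<in> P"
    have "\<not> A x \<subseteq> C"
      using A(2)[OF x] C countable_subset by blast
    then obtain \<alpha> where "\<alpha> \<in> A x" "\<alpha> \<notin> C" by blast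
    then show "x \<in> (\<Union>\<alpha>\<in>\<Theta> - C. {x \<in> P. \<alpha> \<in> A x})"
      using x A(1)[OF x] by blast
  qed
  ultimately show ?thesis by (rule null_subset)
qed

text \<open>Each point is assigned to one member of \<open>\<A>\<close>, which makes the family
  disjoint, and the members are reindexed by points of \<open>Field \<kappa>\<close>, as
  \<open>kappa_additive\<close> requires. Additivity then gives a sum of zeros.\<close>

lemma kappa_additive_null_Union:
  assumes "prob_space M" and \<kappa>: "Card_order \<kappa>" and M: "sets M = Pow (Field \<kappa>)" and add: "kappa_additive \<kappa> M"
    and less: "|\<A>| <o \<kappa>" and \<A>: "\<A> \<subseteq> null_sets M"
  shows "\<Union>\<A> \<in> null_sets M"
proof -
  interpret prob_space M by fact
  have "|\<A>| \<le>o |Field \<kappa>|"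
    using less card_of_Field_ordIso[OF \<kappa>] ordLess_imp_ordLeq ordIso_symmetric ordLeq_ordIso_trans by blast
  then obtain g where g: "inj_on g \<A>" "g ` \<A> \<subseteq> Field \<kappa>"
    unfolding card_of_ordLeq[symmetric] by blast
  define c where "c x = (SOME A. A \<in> \<A> \<and> x \<in> A)" for x
  have c: "c x \<in> \<A>" "x \<in> c x" if "x \<in> \<Union>\<A>" for x
  proof -
    have "\<exists>A. A \<in> \<A> \<and> x \<in> A" using that by blast
    from someI_ex[OF this] show "c x \<in> \<A>" "x \<in> c x" by (simp_all add: c_def)
  qed
  define X where "X i = {x \<in> \<Union>\<A>. g (c x) = i}" for i
  have X: "X (g A) \<subseteq> A" if "A \<in> \<A>" for A
  proof
    fix x assume "x \<in> X (g A)"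
    then have "x \<in> \<Union>\<A>" "g (c x) = g A" by (auto simp: X_def)
    then show "x \<in> A"
      using c[of x] inj_onD[OF g(1), of "c x" A] that by simp
  qed
  have X0: "X i \<in> null_sets M" if i: "i \<in> g ` \<A>" for i
  proof -
    obtain A where A: "A \<in> \<A>" "i = g A" using i by blast
    then have "A \<in> null_sets M" "A \<subseteq> Field \<kappa>"
      using \<A> null_setsD2[of A M] M by auto
    moreover have XA: "X i \<subseteq> A"
      using X[OF A(1)] A(2) by simp
    moreover have "X i \<in> sets M"
      unfolding M using XA \<open>A \<subseteq> Field \<kappa>\<close> by blast
    ultimately show ?thesis
      using null_sets_subset by blast
  qed
  have U: "(\<Union>i\<in>g ` \<A>. X i) = \<Union>\<A>"
    using c by (auto simp: X_def)
  have "|g ` \<A>| <o \<kappa>"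
    using card_of_image less by (rule ordLeq_ordLess_trans)
  moreover have "disjoint_family_on X (g ` \<A>)"
    by (auto simp: disjoint_family_on_def X_def)
  moreover have "\<forall>i\<in>g ` \<A>. X i \<in> sets M"
    using X0 by (auto simp: null_sets_def)
  ultimately have "((\<lambda>i. measure M (X i)) has_sum measure M (\<Union>\<A>)) (g ` \<A>)"
    using add U unfolding kappa_additive_def by fastforce
  moreover have "((\<lambda>i. measure M (X i)) has_sum 0) (g ` \<A>)"
    using X0 measure_eq_0_null_sets by (intro has_sum_0) blast
  ultimately have "measure M (\<Union>\<A>) = 0"
    by (rule has_sum_unique)
  moreover have "\<Union>\<A> \<in> sets M"
    using \<A> null_setsD2 M by fastforce
  ultimately show ?thesis
    by (intro null_setsI) (auto simp: emeasure_eq_measure)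
qed

lemma uncountable_of_card_cardSuc:
  assumes "|A| =o cardSuc natLeq"
  shows "uncountable A"
proof
  assume "countable A"
  then have "|A| \<le>o |UNIV :: nat set|"
    unfolding countable_def card_of_ordLeq[symmetric] by blast
  then have "|A| \<le>o natLeq"
    using card_of_nat by (rule ordLeq_ordIso_trans)
  with assms have "cardSuc natLeq \<le>o natLeq"
    using ordIso_symmetric ordIso_ordLeq_trans by blast
  moreover have "natLeq <o cardSuc natLeq"
    by (rule cardSuc_greater[OF natLeq_Card_order])
  ultimately show False
    using not_ordLess_ordLeq by blast
qed

lemma infinite_of_card_natLeq: "|B| =o natLeq \<Longrightarrow> infinite B"
  using finite_iff_ordLess_natLeq not_ordLess_ordIso by blast

theorem theorem3p3:
  fixes \<kappa> :: "'k rel" and \<theta> :: "'a rel"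
  assumes "real_valued_measurable \<kappa>"
    and "Card_order \<theta>"
    and "\<theta> <o \<kappa>"
  shows "\<not> polarized_arrow \<theta> natLeq (cardSuc natLeq) natLeq"
proof
  assume arrow: "polarized_arrow \<theta> natLeq (cardSuc natLeq) natLeq"
  obtain M where \<kappa>: "Card_order \<kappa>" and M: "prob_space M" "sets M = Pow (Field \<kappa>)" "kappa_additive \<kappa> M"
      "\<forall>x\<in>Field \<kappa>. measure M {x} = 0" "atomless M"
    using assms(1) unfolding real_valued_measurable_def by blast
  interpret prob_space M by (rule M(1))
  interpret real_valued_measure M \<kappa>
  proof
    show "\<Union>\<A> \<in> null_sets M" if "|\<A>| <o \<kappa>" "\<A> \<subseteq> null_sets M" for \<A>
      using kappa_additive_null_Union[OF M(1) \<kappa> M(2,3) that] .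
    show "{x} \<in> null_sets M" if "x \<in> Field \<kappa>" for x
      using that M(2,4) by (intro null_setsI) (auto simp: emeasure_eq_measure)
  qed fact+
  define \<Theta> where "\<Theta> = Field \<theta>"
  have \<Theta>: "|\<Theta>| <o \<kappa>"
    using card_of_Field_ordIso[OF assms(2)] assms(3) unfolding \<Theta>_def by (rule ordIso_ordLess_trans)
  have AB: "\<exists>A B v. A \<subseteq> \<Theta> \<and> uncountable A \<and> infinite B \<and> (\<forall>\<alpha>\<in>A. \<forall>n\<in>B. c (\<alpha>, n) = v)"
    for c :: "'a \<times> nat \<Rightarrow> bool"
  proof -
    obtain A and B :: "nat set" where "A \<subseteq> Field \<theta>" "|A| =o cardSuc natLeq" "|B| =o natLeq" "c constant_on A \<times> B"
      using arrow unfolding polarized_arrow_def by metis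
    then show ?thesis
      using uncountable_of_card_cardSuc infinite_of_card_natLeq unfolding \<Theta>_def constant_on_def by fastforce
  qed
  \<comment> \<open>Needed for \<open>\<Theta> \<times> UNIV\<close> to have the size of
    \<open>\<Theta>\<close>; for finite \<open>\<Theta>\<close> the arrow fails at once, lacking an
    uncountable \<open>A\<close>.\<close>
  have "infinite \<Theta>"
  proof
    assume "finite \<Theta>"
    moreover obtain A where "A \<subseteq> \<Theta>" "uncountable A"
      using AB[of "\<lambda>_. True"] by auto
    ultimately show False
      using finite_subset countable_finite by blast
  qed
  then have "|\<Theta> \<times> (UNIV :: nat set)| =o |\<Theta>|"
    by (intro card_of_Times_infinite_simps) (auto simp: infinite_iff_card_of_nat)
  then have "|\<Theta> \<times> (UNIV :: nat set)| <o \<kappa>"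
    using \<Theta> by (rule ordIso_ordLess_trans)
  moreover obtain \<E> where \<E>: "indep_halves id \<E>" "\<not> |\<E>| <o \<kappa>"
    by (rule large_indep_halves)
  moreover have "\<kappa> \<le>o |\<E>|"
    using \<E>(2) \<kappa> by (simp add: not_ordLess_iff_ordLeq card_of_Well_order card_order_on_def)
  ultimately have "|\<Theta> \<times> (UNIV :: nat set)| \<le>o |\<E>|"
    using ordLess_ordLeq_trans ordLess_imp_ordLeq by blast
  then obtain E where inj: "inj_on E (\<Theta> \<times> (UNIV :: nat set))" and im: "E ` (\<Theta> \<times> UNIV) \<subseteq> \<E>"
    unfolding card_of_ordLeq[symmetric] by blast
  have E: "indep_halves E (\<Theta> \<times> UNIV)"
    unfolding indep_halves_def
  proof (intro conjI ballI allI impI)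
    show "E i \<in> sets M" if "i \<in> \<Theta> \<times> UNIV" for i
      using indep_halvesD(1)[OF \<E>(1), of "E i"] im that by auto
    show "measure M (space M \<inter> (\<Inter>i\<in>F. E i)) = (1/2) ^ card F" if "F \<subseteq> \<Theta> \<times> UNIV" "finite F" for F
    proof -
      have "measure M (space M \<inter> (\<Inter>S\<in>E ` F. id S)) = (1/2) ^ card (E ` F)"
        using that im by (intro indep_halvesD(2)[OF \<E>(1)]) auto
      moreover have "card (E ` F) = card F"
        by (rule card_image[OF inj_on_subset[OF inj that(1)]])
      ultimately show ?thesis by simp
    qed
  qed
  \<comment> \<open>Every point \<open>x\<close> defines a colouring, to which the assumed arrow
    applies; \<open>v\<close> records the colour obtained.\<close>
  have "\<forall>x. \<exists>A B v. A \<subseteq> \<Theta> \<and> uncountable A \<and> infinite B \<and> (\<forall>\<alpha>\<in>A. \<forall>n\<in>B. (x \<in> E (\<alpha>, n)) = v)"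
  proof
    fix x
    show "\<exists>A B v. A \<subseteq> \<Theta> \<and> uncountable A \<and> infinite B \<and> (\<forall>\<alpha>\<in>A. \<forall>n\<in>B. (x \<in> E (\<alpha>, n)) = v)"
      by (rule AB[of "\<lambda>p. x \<in> E p"])
  qed
  then obtain A B v where ABv: "\<And>x. A x \<subseteq> \<Theta>" "\<And>x. uncountable (A x)" "\<And>x. infinite (B x)"
      "\<And>x \<alpha> n. \<alpha> \<in> A x \<Longrightarrow> n \<in> B x \<Longrightarrow> (x \<in> E (\<alpha>, n)) = v x"
    by metis
  have "{x \<in> Field \<kappa>. v x} \<in> null_sets M"
    using ABv by (intro indep_halves_monochromatic_null[OF E \<Theta>, where A = A and B = B]) auto
  \<comment> \<open>The colour \<open>False\<close> for \<open>E\<close> is the colour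
    \<open>True\<close> for the complements, which are again independent.\<close>
  moreover have "{x \<in> Field \<kappa>. \<not> v x} \<in> null_sets M"
    using ABv by (intro indep_halves_monochromatic_null[OF indep_halves_compl[OF E] \<Theta>, where A = A and B = B]) (auto simp: space_M)
  ultimately have "{x \<in> Field \<kappa>. v x} \<union> {x \<in> Field \<kappa>. \<not> v x} \<in> null_sets M"
    by (rule null_sets.Un)
  moreover have "{x \<in> Field \<kappa>. v x} \<union> {x \<in> Field \<kappa>. \<not> v x} = Field \<kappa>"
    by blast
  ultimately show False
    using not_null_Field by simp
qed

end
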